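(* Let $\varepsilon_k\to0$ be such that $\rho^{\varepsilon_k}\to\rho$ strongly in $L^p(0,T;W^{-1,1}(\Omega))$ (for some $p\in[1,\infty)$ and every $T>0$), and let $\varepsilon_k'$ be a subsequence of $\varepsilon_k$ such that for almost every $t>0$ every accumulation point $v$ of $\{u^{\varepsilon_k'}(t,\cdot)\}$ satisfies $v'''=0$ in $\{v>0\}$, $\int_\Omega v\,dx=1$, $\{v>0\}\subset\Sigma(t)$ and $\partial\{v>0\}\cap\Sigma(t)=\emptyset$. Then for almost every $t>0$: if $\Sigma(t)=(a,b)$ has only one connected component, compactly contained in $\Omega$, then the sequence $\{u^{\varepsilon_k'}(t,\cdot)\}$ has only one accumulation point $v\in H^1(\Omega)$; it is supported in $(a,b)$ and satisfies, for some constant $\lambda$, $$v''(x)=-\lambda\ \text{ in }(a,b),\qquad\int_{(a,b)}v(x)\,dx=1.$$ In particular, for almost every such $t>0$ the sequence $u^{\varepsilon_k'}(t,\cdot)$ converges to $v$ uniformly and weakly in $H^1(\Omega)$.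
   Context: $W^{-1,1}(\Omega)$ is the space of distributions $f_0+\partial_xf_1$ with $f_0,f_1\in L^1(\Omega)$, with the usual (infimum) norm. $B_r(x)=(x-r,x+r)$. Accumulation points of $\{u^{\varepsilon_k'}(t,\cdot)\}$ are taken with respect to uniform convergence (equivalently weak convergence in $H^1(\Omega)$). For a.e. $t>0$, $\Sigma(t)=\{x\in\Omega:\exists r>0,\ \int_{B_r(x)\cap\Omega}[1-\rho(t,y)]\,dy=0\}$. "Supported in $(a,b)$" means vanishing outside $(a,b)$. Let $\Omega\subset\mathbb R$ be a bounded open interval, $n\in(0,3)$, and $u_{in}\in H^1(\Omega)$ with $u_{in}\ge 0$, $\int_\Omega u_{in}\,dx=1$. For $\varepsilon\in(0,1/2]$ the thin film problem is $|\ln\varepsilon|^{-1}\partial_t u+\partial_x\big((\varepsilon^{3-n}u^n+u^3)\partial_{xxx}u\big)=0$ in $(0,\infty)\times\Omega$, with $(\varepsilon^{3-n}u^n+u^3)u_{xxx}=0$ and $u_x=0$ on $(0,\infty)\times\partial\Omega$, and $u(0,\cdot)=u_{in}$. (Weak form: $|\ln\varepsilon|^{-1}\big(\int_0^\infty\!\int_\Omega u\psi_t+\int_\Omega u_{in}\psi(0,\cdot)\big)+\iint_{\{u>0\}}(\varepsilon^{3-n}u^n+u^3)u_{xxx}\psi_x=0$ for all $\psi\in C_c^\infty([0,\infty)\times\overline\Omega)$.) Let $B(s)=\int_0^s\int_r^\infty\frac{1}{v^{n-1}+v^2}\,dv\,dr$ and $B^\varepsilon(s)=|\ln\varepsilon|^{-1}B(s/\varepsilon)$.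 For each $\varepsilon$, $u^\varepsilon$ denotes a fixed continuous non-negative weak solution such that, with $\rho^\varepsilon:=B^\varepsilon(u^\varepsilon)$, for every $T>0$: (i) $u^\varepsilon\in L^\infty((0,T);H^1(\Omega))$, $u^\varepsilon u^\varepsilon_{xxx}\in L^2((0,T)\times\Omega)$; (ii) $\int_\Omega u^\varepsilon(t)\,dx=\int_\Omega u_{in}\,dx$ for all $t>0$; (iii) $\frac12\int_\Omega|u^\varepsilon_x(t)|^2dx+\int_0^t\int_{\{u^\varepsilon>0\}}|\ln\varepsilon|(\varepsilon^{3-n}(u^\varepsilon)^n+(u^\varepsilon)^3)|u^\varepsilon_{xxx}|^2dx\,ds\le\frac12\int_\Omega|\partial_xu_{in}|^2dx$ for all $t>0$; (iv) $\int_\Omega\rho^\varepsilon(t)\,dx\ge\int_0^t\int_\Omega u^\varepsilon|u^\varepsilon_{xx}|^2dx\,ds+\int_\Omega\rho^\varepsilon(0)\,dx$ for all $t>0$ (with $u^\varepsilon|u^\varepsilon_{xx}|^2:=0$ on $\{u^\varepsilon=0\}$). *)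

theory Defs
  imports "HOL-Analysis.Analysis"
begin

section \<open>Smooth functions and weak derivatives\<close>

definition dir_deriv :: "'a::euclidean_space \<Rightarrow> ('a \<Rightarrow> real) \<Rightarrow> 'a \<Rightarrow> real" where
  "dir_deriv b f = (\<lambda>x. frechet_derivative f (at x) b)"

primrec Ck :: "nat \<Rightarrow> ('a::euclidean_space \<Rightarrow> real) \<Rightarrow> bool" where
  "Ck 0 f \<longleftrightarrow> continuous_on UNIV f"
| "Ck (Suc k) f \<longleftrightarrow> (\<forall>x. f differentiable (at x)) \<and> (\<forall>b\<in>Basis. Ck k (dir_deriv b f))"

definition smooth_fun :: "('a::euclidean_space \<Rightarrow> real) \<Rightarrow> bool" where
  "smooth_fun f \<longleftrightarrow> (\<forall>k. Ck k f)"

definition test_fun :: "'a::euclidean_space set \<Rightarrow> ('a \<Rightarrow> real) \<Rightarrow> bool" where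
  "test_fun U \<phi> \<longleftrightarrow> smooth_fun \<phi> \<and> compact (closure {x. \<phi> x \<noteq> 0}) \<and> closure {x. \<phi> x \<noteq> 0} \<subseteq> U"

definition loc_integrable :: "'a::euclidean_space set \<Rightarrow> ('a \<Rightarrow> real) \<Rightarrow> bool" where
  "loc_integrable U f \<longleftrightarrow> (\<forall>K. compact K \<and> K \<subseteq> U \<longrightarrow> set_integrable lborel K f)"

text \<open>\<open>g\<close> is the distributional derivative of order \<open>k\<close> of \<open>f\<close> in direction \<open>b\<close> on the open set \<open>U\<close>.
  Here and below, elements of Lebesgue spaces are represented by Borel functions.\<close>

definition has_weak_deriv ::
    "'a::euclidean_space \<Rightarrow> nat \<Rightarrow> 'a set \<Rightarrow> ('a \<Rightarrow> real) \<Rightarrow> ('a \<Rightarrow> real) \<Rightarrow> bool" where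
  "has_weak_deriv b k U f g \<longleftrightarrow> loc_integrable U f \<and> loc_integrable U g \<and>
     (\<forall>\<phi>. test_fun U \<phi> \<longrightarrow>
        (LINT x:U|lborel. f x * (dir_deriv b ^^ k) \<phi> x) = (-1) ^ k * (LINT x:U|lborel. g x * \<phi> x))"

text \<open>Weak derivatives are unique up to null sets; \<open>weak_deriv\<close> picks a representative. It is only
  meaningful where \<open>weakly_diff\<close> holds.\<close>

definition weakly_diff :: "'a::euclidean_space \<Rightarrow> nat \<Rightarrow> 'a set \<Rightarrow> ('a \<Rightarrow> real) \<Rightarrow> bool" where
  "weakly_diff b k U f \<longleftrightarrow> (\<exists>g. has_weak_deriv b k U f g)"

definition weak_deriv :: "'a::euclidean_space \<Rightarrow> nat \<Rightarrow> 'a set \<Rightarrow> ('a \<Rightarrow> real) \<Rightarrow> 'a \<Rightarrow> real" where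
  "weak_deriv b k U f = (SOME g. has_weak_deriv b k U f g)"


section \<open>Function spaces on an open subset of the real line\<close>

definition L2_on :: "'a::euclidean_space set \<Rightarrow> ('a \<Rightarrow> real) \<Rightarrow> bool" where
  "L2_on U f \<longleftrightarrow> set_borel_measurable lborel U f \<and> set_integrable lborel U (\<lambda>x. (f x)\<^sup>2)"

definition H1 :: "real set \<Rightarrow> (real \<Rightarrow> real) \<Rightarrow> bool" where
  "H1 U f \<longleftrightarrow> L2_on U f \<and> weakly_diff 1 1 U f \<and> L2_on U (weak_deriv 1 1 U f)"

definition H1_inner :: "real set \<Rightarrow> (real \<Rightarrow> real) \<Rightarrow> (real \<Rightarrow> real) \<Rightarrow> real" where
  "H1_inner U f g = (LINT x:U|lborel. f x * g x)
     + (LINT x:U|lborel. weak_deriv 1 1 U f x * weak_deriv 1 1 U g x)"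

definition H1_norm :: "real set \<Rightarrow> (real \<Rightarrow> real) \<Rightarrow> real" where
  "H1_norm U f = sqrt (H1_inner U f f)"

definition weak_conv_H1 :: "real set \<Rightarrow> (nat \<Rightarrow> real \<Rightarrow> real) \<Rightarrow> (real \<Rightarrow> real) \<Rightarrow> bool" where
  "weak_conv_H1 U f v \<longleftrightarrow> (\<forall>k. H1 U (f k)) \<and> H1 U v \<and>
     (\<forall>g. H1 U g \<longrightarrow> (\<lambda>k. H1_inner U (f k) g) \<longlonglongrightarrow> H1_inner U v g)"

text \<open>The infimum norm on distributions \<open>\<Lambda>\<close> of the form \<open>f0 + f1'\<close> with integrable \<open>f0\<close>, \<open>f1\<close>;
  it is \<open>\<infinity>\<close> iff \<open>\<Lambda>\<close> does not belong to \<open>W^{-1,1}\<close>.\<close>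

definition Wm11_norm :: "real set \<Rightarrow> ((real \<Rightarrow> real) \<Rightarrow> real) \<Rightarrow> ennreal" where
  "Wm11_norm U \<Lambda> =
     (INF (f0, f1) \<in> {(f0, f1). set_integrable lborel U f0 \<and> set_integrable lborel U f1 \<and>
         (\<forall>\<phi>. test_fun U \<phi> \<longrightarrow>
            \<Lambda> \<phi> = (LINT x:U|lborel. f0 x * \<phi> x) - (LINT x:U|lborel. f1 x * dir_deriv 1 \<phi> x))}.
       ennreal ((LINT x:U|lborel. \<bar>f0 x\<bar>) + (LINT x:U|lborel. \<bar>f1 x\<bar>)))"

definition distr_of :: "real set \<Rightarrow> (real \<Rightarrow> real) \<Rightarrow> (real \<Rightarrow> real) \<Rightarrow> real" where
  "distr_of U f = (\<lambda>\<phi>. LINT x:U|lborel. f x * \<phi> x)"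

text \<open>The \<open>p\<close>-th power of the norm of \<open>L^p\<close>(0,T; \<open>W^{-1,1}\<close>), for families \<open>f t\<close> of integrable functions
  (so that the inner norm is finite and \<open>enn2real\<close> is harmless). For such jointly measurable \<open>f\<close> the
  map \<open>t \<mapsto> f t\<close> is strongly measurable, first with values in \<open>L^1\<close> and hence also in \<open>W^{-1,1}\<close>.\<close>

definition Lp_Wm11_norm_pow :: "real \<Rightarrow> real \<Rightarrow> real set \<Rightarrow> (real \<Rightarrow> real \<Rightarrow> real) \<Rightarrow> ennreal" where
  "Lp_Wm11_norm_pow p T U f =
     (\<integral>\<^sup>+ t\<in>{0<..<T}. ennreal (enn2real (Wm11_norm U (distr_of U (f t))) powr p) \<partial>lborel)"

definition in_Lp_Wm11 :: "real \<Rightarrow> real \<Rightarrow> real set \<Rightarrow> (real \<Rightarrow> real \<Rightarrow> real) \<Rightarrow> bool" where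
  "in_Lp_Wm11 p T U f \<longleftrightarrow>
     set_borel_measurable lborel ({0<..<T} \<times> U) (\<lambda>(t, x). f t x) \<and>
     (AE t in lborel. 0 < t \<and> t < T \<longrightarrow> set_integrable lborel U (f t)) \<and>
     Lp_Wm11_norm_pow p T U f < \<infinity>"

definition conv_Lp_Wm11 ::
    "real \<Rightarrow> real \<Rightarrow> real set \<Rightarrow> (nat \<Rightarrow> real \<Rightarrow> real \<Rightarrow> real) \<Rightarrow> (real \<Rightarrow> real \<Rightarrow> real) \<Rightarrow> bool" where
  "conv_Lp_Wm11 p T U f g \<longleftrightarrow> (\<forall>k. in_Lp_Wm11 p T U (f k)) \<and> in_Lp_Wm11 p T U g \<and>
     (\<lambda>k. Lp_Wm11_norm_pow p T U (\<lambda>t x. f k t x - g t x)) \<longlonglongrightarrow> 0"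


section \<open>The thin film problem\<close>

definition mobility :: "real \<Rightarrow> real \<Rightarrow> real \<Rightarrow> real" where
  "mobility n \<epsilon> s = \<epsilon> powr (3 - n) * s powr n + s ^ 3"

definition B_fun :: "real \<Rightarrow> real \<Rightarrow> real" where
  "B_fun n s = (LINT r:{0<..<s}|lborel. (LINT v:{r<..}|lborel. 1 / (v powr (n - 1) + v\<^sup>2)))"

definition B_eps :: "real \<Rightarrow> real \<Rightarrow> real \<Rightarrow> real" where
  "B_eps n \<epsilon> s = B_fun n (s / \<epsilon>) / \<bar>ln \<epsilon>\<bar>"

definition rho_of :: "real \<Rightarrow> real \<Rightarrow> (real \<Rightarrow> real \<Rightarrow> real) \<Rightarrow> real \<Rightarrow> real \<Rightarrow> real" where
  "rho_of n \<epsilon> u = (\<lambda>t x. B_eps n \<epsilon> (u t x))"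

definition pos_set :: "real set \<Rightarrow> (real \<Rightarrow> real \<Rightarrow> real) \<Rightarrow> (real \<times> real) set" where
  "pos_set \<Omega> u = {(t, x). 0 < t \<and> x \<in> \<Omega> \<and> 0 < u t x}"

text \<open>The derivatives \<open>u_xx\<close> and \<open>u_xxx\<close> are distributional derivatives on the open set where \<open>u > 0\<close>;
  expressions involving them are extended by zero to \<open>u = 0\<close>, i.e. integrated over \<open>pos_set\<close> only.\<close>

definition u_x :: "real set \<Rightarrow> (real \<Rightarrow> real \<Rightarrow> real) \<Rightarrow> real \<Rightarrow> real \<Rightarrow> real" where
  "u_x \<Omega> u = (\<lambda>t. weak_deriv 1 1 \<Omega> (u t))"

definition u_xx :: "real set \<Rightarrow> (real \<Rightarrow> real \<Rightarrow> real) \<Rightarrow> real \<times> real \<Rightarrow> real" where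
  "u_xx \<Omega> u = weak_deriv (0, 1) 2 (pos_set \<Omega> u) (\<lambda>(t, x). u t x)"

definition u_xxx :: "real set \<Rightarrow> (real \<Rightarrow> real \<Rightarrow> real) \<Rightarrow> real \<times> real \<Rightarrow> real" where
  "u_xxx \<Omega> u = weak_deriv (0, 1) 3 (pos_set \<Omega> u) (\<lambda>(t, x). u t x)"

text \<open>Test functions range over restrictions to \<open>[0,\<infinity>) \<times> closure \<Omega>\<close> of smooth compactly supported
  functions on the plane; this encodes the zero-flux condition and the initial condition.
  The flux is integrable on bounded time intervals by the energy inequality below.\<close>

definition weak_form :: "real set \<Rightarrow> real \<Rightarrow> real \<Rightarrow> (real \<Rightarrow> real) \<Rightarrow> (real \<Rightarrow> real \<Rightarrow> real) \<Rightarrow> bool" where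
  "weak_form \<Omega> n \<epsilon> u_in u \<longleftrightarrow> (\<forall>\<psi>. test_fun UNIV \<psi> \<longrightarrow>
     inverse \<bar>ln \<epsilon>\<bar> *
       ((LINT (t, x):({0<..} \<times> \<Omega>)|lborel. u t x * dir_deriv (1, 0) \<psi> (t, x))
        + (LINT x:\<Omega>|lborel. u_in x * \<psi> (0, x)))
     + (LINT (t, x):pos_set \<Omega> u|lborel.
          mobility n \<epsilon> (u t x) * u_xxx \<Omega> u (t, x) * dir_deriv (0, 1) \<psi> (t, x)) = 0)"

text \<open>The condition \<open>u_x = 0\<close> on the lateral boundary is not visible in the weak form. It is imposed,
  for almost every time, at the boundary points where \<open>u > 0\<close>: there \<open>u t\<close> is \<open>C^2\<close> up to the boundary,
  whereas \<open>u_x\<close> need not have a trace where \<open>u = 0\<close>.\<close>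

definition neumann_bc :: "real set \<Rightarrow> (real \<Rightarrow> real \<Rightarrow> real) \<Rightarrow> bool" where
  "neumann_bc \<Omega> u \<longleftrightarrow> (AE t in lborel. 0 < t \<longrightarrow>
     (\<forall>x\<in>frontier \<Omega>. 0 < u t x \<longrightarrow> (u t has_real_derivative 0) (at x within closure \<Omega>)))"

text \<open>Measurability in \<open>L^\<infinity>(0,T; H^1)\<close> is automatic, \<open>u\<close> being continuous.\<close>

definition regularity :: "real set \<Rightarrow> (real \<Rightarrow> real \<Rightarrow> real) \<Rightarrow> bool" where
  "regularity \<Omega> u \<longleftrightarrow>
     weakly_diff (0, 1) 3 (pos_set \<Omega> u) (\<lambda>(t, x). u t x) \<and>
     (\<forall>T>0. (\<exists>C. AE t in lborel. 0 < t \<and> t < T \<longrightarrow> H1 \<Omega> (u t) \<and> H1_norm \<Omega> (u t) \<le> C) \<and>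
        L2_on (pos_set \<Omega> u \<inter> {0<..<T} \<times> UNIV) (\<lambda>(t, x). u t x * u_xxx \<Omega> u (t, x)))"

definition mass_conservation :: "real set \<Rightarrow> (real \<Rightarrow> real) \<Rightarrow> (real \<Rightarrow> real \<Rightarrow> real) \<Rightarrow> bool" where
  "mass_conservation \<Omega> u_in u \<longleftrightarrow>
     (\<forall>t>0. (LINT x:\<Omega>|lborel. u t x) = (LINT x:\<Omega>|lborel. u_in x))"

definition energy_inequality ::
    "real set \<Rightarrow> real \<Rightarrow> real \<Rightarrow> (real \<Rightarrow> real) \<Rightarrow> (real \<Rightarrow> real \<Rightarrow> real) \<Rightarrow> bool" where
  "energy_inequality \<Omega> n \<epsilon> u_in u \<longleftrightarrow> (\<forall>t>0. H1 \<Omega> (u t) \<and>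
     ennreal (1/2) * (\<integral>\<^sup>+ x\<in>\<Omega>. ennreal ((u_x \<Omega> u t x)\<^sup>2) \<partial>lborel)
       + (\<integral>\<^sup>+ (s, x)\<in>pos_set \<Omega> u \<inter> {0<..<t} \<times> UNIV.
            ennreal (\<bar>ln \<epsilon>\<bar> * mobility n \<epsilon> (u s x) * (u_xxx \<Omega> u (s, x))\<^sup>2) \<partial>lborel)
     \<le> ennreal (1/2) * (\<integral>\<^sup>+ x\<in>\<Omega>. ennreal ((weak_deriv 1 1 \<Omega> u_in x)\<^sup>2) \<partial>lborel))"

definition entropy_inequality ::
    "real set \<Rightarrow> real \<Rightarrow> real \<Rightarrow> (real \<Rightarrow> real \<Rightarrow> real) \<Rightarrow> bool" where
  "entropy_inequality \<Omega> n \<epsilon> u \<longleftrightarrow>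
     weakly_diff (0, 1) 2 (pos_set \<Omega> u) (\<lambda>(t, x). u t x) \<and>
     (\<forall>t>0. (\<integral>\<^sup>+ x\<in>\<Omega>. ennreal (rho_of n \<epsilon> u t x) \<partial>lborel)
        \<ge> (\<integral>\<^sup>+ (s, x)\<in>pos_set \<Omega> u \<inter> {0<..<t} \<times> UNIV. ennreal (u s x * (u_xx \<Omega> u (s, x))\<^sup>2) \<partial>lborel)
          + (\<integral>\<^sup>+ x\<in>\<Omega>. ennreal (rho_of n \<epsilon> u 0 x) \<partial>lborel))"

definition thin_film_solution ::
    "real set \<Rightarrow> real \<Rightarrow> real \<Rightarrow> (real \<Rightarrow> real) \<Rightarrow> (real \<Rightarrow> real \<Rightarrow> real) \<Rightarrow> bool" where
  "thin_film_solution \<Omega> n \<epsilon> u_in u \<longleftrightarrow>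
     continuous_on ({0..} \<times> closure \<Omega>) (\<lambda>(t, x). u t x) \<and>
     (\<forall>t\<ge>0. \<forall>x\<in>closure \<Omega>. 0 \<le> u t x) \<and>
     weak_form \<Omega> n \<epsilon> u_in u \<and>
     neumann_bc \<Omega> u \<and>
     regularity \<Omega> u \<and>
     mass_conservation \<Omega> u_in u \<and>
     energy_inequality \<Omega> n \<epsilon> u_in u \<and>
     entropy_inequality \<Omega> n \<epsilon> u"


section \<open>Accumulation points and the set Sigma(t)\<close>

definition accum_point :: "real set \<Rightarrow> (nat \<Rightarrow> real \<Rightarrow> real) \<Rightarrow> (real \<Rightarrow> real) \<Rightarrow> bool" where
  "accum_point \<Omega> f v \<longleftrightarrow> (\<exists>s. strict_mono s \<and> uniform_limit \<Omega> (\<lambda>j. f (s j)) v sequentially)"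

definition Sigma_set :: "real set \<Rightarrow> (real \<Rightarrow> real \<Rightarrow> real) \<Rightarrow> real \<Rightarrow> real set" where
  "Sigma_set \<Omega> \<rho> t = {x \<in> \<Omega>. \<exists>r>0. (LINT y:(ball x r \<inter> \<Omega>)|lborel. 1 - \<rho> t y) = 0}"

end

theory Submission
  imports Defs "HOL-Computational_Algebra.Polynomial" "HOL-Complex_Analysis.Great_Picard"
begin

text \<open>At a fixed time the functions \<open>u\<^sup>\<epsilon>(t, \<cdot>)\<close> have mass one and uniformly bounded Dirichlet energy, so they
  are equi-Hoelder and Arzela--Ascoli makes every subsequence accumulate uniformly. The positivity set of
  an accumulation point is contained in \<open>\<Sigma>(t) = (a, b)\<close> and has no boundary point there, hence it is all of
  \<open>(a, b)\<close>; by du Bois-Reymond the accumulation point is a quadratic polynomial there, it vanishes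
  at \<open>a\<close> and \<open>b\<close>, and its mass is one. This determines it, so the whole sequence converges. Weak
  convergence in \<open>H\<^sup>1\<close> follows because the derivatives are bounded in \<open>L\<^sup>2\<close> and their integrals over intervals
  converge.\<close>

section \<open>Smooth bump functions\<close>

text \<open>The condition v = 0 at a and b comes from compact containment: both ends lie in
  \<Omega>, where the accumulation point is continuous, but outside \<Sigma>(t), so it is not
  positive there. Mass one then forces the profile 6 (x - a) (b - x) / (b - a)^3, so that \<lambda>
  = 12 / (b - a)^3. The obstacle is that \<open>weak_deriv\<close> is a representative picked by
  \<open>SOME\<close>, accessible only through integrability and the tested identity. The bridge is
  \<open>weak_deriv_FTC\<close>: the integral of a weak derivative over an interval is the increment
  of the continuous function. It yields the Hoelder bound, the a.e. uniqueness that puts an explicit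
  function into \<open>H1\<close>, and the convergence of the derivatives over intervals. Mass and
  energy are controlled at every t > 0, so the exceptional null set is the one in the hypothesis on
  accumulation points.\<close>

lemma dir_deriv_real: "(f has_real_derivative D) (at x) \<Longrightarrow> dir_deriv 1 f x = D"
  unfolding dir_deriv_def
  by (metis frechet_derivative_at has_field_derivative_def mult.right_neutral)

text \<open>The only basis vector of the line is 1. Naming an explicit derivative replaces the
  choice-based \<open>frechet_derivative\<close>, so the closure properties below can be proved by
  exhibiting f' and inducting on k.\<close>

lemma Ck_Suc_real:
  fixes f :: "real \<Rightarrow> real"
  shows "Ck (Suc k) f \<longleftrightarrow> (\<exists>f'. (\<forall>x. (f has_real_derivative f' x) (at x)) \<and> Ck k f')"
proof
  assume L: "Ck (Suc k) f"
  have "(f has_real_derivative dir_deriv 1 f x) (at x)" for x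
  proof -
    from L have "f differentiable (at x)" by simp
    then obtain D where "(f has_real_derivative D) (at x)"
      using real_differentiable_def by blast
    then show ?thesis using dir_deriv_real by metis
  qed
  with L show "\<exists>f'. (\<forall>x. (f has_real_derivative f' x) (at x)) \<and> Ck k f'" by auto
next
  assume "\<exists>f'. (\<forall>x. (f has_real_derivative f' x) (at x)) \<and> Ck k f'"
  then obtain f' where d: "\<And>x. (f has_real_derivative f' x) (at x)" and c: "Ck k f'" by auto
  have "dir_deriv 1 f = f'" using dir_deriv_real[OF d] by auto
  with d c show "Ck (Suc k) f"
    using real_differentiable_def by auto
qed

lemma Ck_real_continuous: "Ck k (f :: real \<Rightarrow> real) \<Longrightarrow> continuous_on UNIV f"
  by (metis Ck.simps(1) Ck_Suc_real DERIV_isCont continuous_at_imp_continuous_on old.nat.exhaust)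

lemma Ck_real_mono: "Ck (Suc k) (f :: real \<Rightarrow> real) \<Longrightarrow> Ck k f"
proof (induction k arbitrary: f)
  case 0
  then show ?case using Ck_real_continuous Ck.simps(1) by blast
next
  case (Suc k)
  then show ?case by (metis Ck_Suc_real)
qed

lemma Ck_real_add: "Ck k f \<Longrightarrow> Ck k g \<Longrightarrow> Ck k (\<lambda>x::real. f x + g x)"
proof (induction k arbitrary: f g)
  case 0
  then show ?case by (simp add: continuous_on_add)
next
  case (Suc k)
  obtain f' g' where "\<And>x. (f has_real_derivative f' x) (at x)" "Ck k f'"
    "\<And>x. (g has_real_derivative g' x) (at x)" "Ck k g'"
    using Suc.prems by (auto simp: Ck_Suc_real simp del: Ck.simps(2))
  then show ?case unfolding Ck_Suc_real
    by (intro exI[of _ "\<lambda>x. f' x + g' x"]) (auto intro!: derivative_eq_intros Suc.IH)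
qed

lemma Ck_real_mult: "Ck k f \<Longrightarrow> Ck k g \<Longrightarrow> Ck k (\<lambda>x::real. f x * g x)"
proof (induction k arbitrary: f g)
  case 0
  then show ?case by (simp add: continuous_on_mult)
next
  case (Suc k)
  obtain f' g' where d: "\<And>x. (f has_real_derivative f' x) (at x)" "Ck k f'"
    "\<And>x. (g has_real_derivative g' x) (at x)" "Ck k g'"
    using Suc.prems by (auto simp: Ck_Suc_real simp del: Ck.simps(2))
  \<comment> \<open>The product rule mixes f and g with their derivatives, so the factors themselves
    are also needed at the lower order k.\<close>
  have "Ck k f" "Ck k g" by (rule Suc.prems[THEN Ck_real_mono])+
  with d show ?case unfolding Ck_Suc_real
    by (intro exI[of _ "\<lambda>x. f' x * g x + g' x * f x"])
       (auto intro!: derivative_eq_intros Suc.IH Ck_real_add)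
qed

lemma Ck_real_const: "Ck k (\<lambda>x::real. c)"
proof (induction k arbitrary: c)
  case (Suc k)
  show ?case unfolding Ck_Suc_real by (intro exI[of _ "\<lambda>x. 0"]) (simp add: Suc)
qed simp

lemma Ck_real_affine: "Ck k f \<Longrightarrow> Ck k (\<lambda>x::real. f (m * x + c))"
proof (induction k arbitrary: f)
  case 0
  then show ?case by (auto intro!: continuous_on_compose2[of UNIV f] continuous_intros)
next
  case (Suc k)
  obtain f' where d: "\<And>x. (f has_real_derivative f' x) (at x)" "Ck k f'"
    using Suc.prems by (auto simp: Ck_Suc_real simp del: Ck.simps(2))
  have "((\<lambda>x. f (m * x + c)) has_real_derivative m * f' (m * x + c)) (at x)" for x
  proof -
    have "((\<lambda>x. m * x + c) has_real_derivative m) (at x)"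
      by (auto intro!: derivative_eq_intros)
    from DERIV_chain2[where f = f, OF d(1) this] show ?thesis by (simp add: mult.commute)
  qed
  with d show ?case unfolding Ck_Suc_real
    by (intro exI[of _ "\<lambda>x. m * f' (m * x + c)"]) (auto intro!: Suc.IH Ck_real_mult Ck_real_const)
qed


lemma smooth_fun_add: "smooth_fun f \<Longrightarrow> smooth_fun g \<Longrightarrow> smooth_fun (\<lambda>x::real. f x + g x)"
  and smooth_fun_mult: "smooth_fun f \<Longrightarrow> smooth_fun g \<Longrightarrow> smooth_fun (\<lambda>x::real. f x * g x)"
  and smooth_fun_const: "smooth_fun (\<lambda>x::real. c)"
  and smooth_fun_affine: "smooth_fun f \<Longrightarrow> smooth_fun (\<lambda>x::real. f (m * x + c))"
  by (simp_all add: smooth_fun_def Ck_real_add Ck_real_mult Ck_real_const Ck_real_affine)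

lemma smooth_fun_deriv:
  fixes f :: "real \<Rightarrow> real"
  assumes "smooth_fun f"
  shows "(f has_real_derivative dir_deriv 1 f x) (at x)" and "smooth_fun (dir_deriv 1 f)"
proof -
  have "f differentiable (at x)" using assms by (metis Ck.simps(2) smooth_fun_def)
  then obtain D where "(f has_real_derivative D) (at x)" using real_differentiable_def by blast
  then show "(f has_real_derivative dir_deriv 1 f x) (at x)" using dir_deriv_real by metis
  have "\<forall>k. Ck (Suc k) f" using assms smooth_fun_def by blast
  then show "smooth_fun (dir_deriv 1 f)" unfolding smooth_fun_def by simp
qed

lemma smooth_fun_primitive:
  assumes "smooth_fun f" and "\<And>x::real. (F has_real_derivative f x) (at x)"
  shows "smooth_fun F"
  unfolding smooth_fun_def
proof
  fix k
  have "Ck (Suc k) F" using assms unfolding Ck_Suc_real smooth_fun_def by blast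
  then show "Ck k F" by (rule Ck_real_mono)
qed

lemma smooth_fun_continuous: "smooth_fun (f :: real \<Rightarrow> real) \<Longrightarrow> continuous_on S f"
  by (metis Ck.simps(1) continuous_on_subset smooth_fun_def subset_UNIV)

text \<open>The polynomial factor makes the family closed under differentiation, whence its smoothness.\<close>

definition flat_fun :: "real poly \<Rightarrow> real \<Rightarrow> real" where
  "flat_fun p x = (if 0 < x then poly p (1 / x) * exp (- 1 / x) else 0)"

lemma tendsto_poly_div_exp: "((\<lambda>t::real. poly p t / exp t) \<longlongrightarrow> 0) at_top"
proof -
  have "((\<lambda>t. \<Sum>i\<le>degree p. coeff p i * (t ^ i / exp t)) \<longlongrightarrow> (\<Sum>i\<le>degree p. coeff p i * 0)) at_top"
    by (intro tendsto_intros tendsto_power_div_exp_0)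
  moreover have "(\<lambda>t. \<Sum>i\<le>degree p. coeff p i * (t ^ i / exp t)) = (\<lambda>t. poly p t / exp t)"
    by (simp add: poly_altdef sum_divide_distrib)
  ultimately show ?thesis by simp
qed

text \<open>With y = 1/x the chain rule gives -y^2 (p' - p)(y) exp(-y), whence the polynomial X^2 (p
  - p'). At x = 0 both one-sided difference quotients tend to 0, because exp(-y) beats every
  polynomial as y tends to infinity.\<close>

lemma flat_fun_deriv:
  "(flat_fun p has_real_derivative flat_fun (monom 1 2 * (p - pderiv p)) x) (at x)"
proof -
  consider "x < 0" | "0 < x" | "x = 0" by linarith
  then show ?thesis
  proof cases
    case 1
    have "((\<lambda>x. 0::real) has_real_derivative 0) (at x)" by simp
    then have "(flat_fun p has_real_derivative 0) (at x)"
      by (rule has_field_derivative_transform_within_open[of _ _ _ "{..<0}"])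
        (use 1 in \<open>auto simp: flat_fun_def\<close>)
    then show ?thesis using 1 by (simp add: flat_fun_def)
  next
    case 2
    have "((\<lambda>x. poly p (1 / x) * exp (- 1 / x)) has_real_derivative
       flat_fun (monom 1 2 * (p - pderiv p)) x) (at x)"
    proof -
      have i: "((\<lambda>x. c / x) has_real_derivative - c * (1 / x)\<^sup>2) (at x)" for c
        using 2 by (auto intro!: derivative_eq_intros simp: power2_eq_square)
      have "((\<lambda>x. poly p (1 / x)) has_real_derivative poly (pderiv p) (1 / x) * (- 1 * (1 / x)\<^sup>2)) (at x)"
        by (rule DERIV_chain2[OF poly_DERIV i])
      moreover have "((\<lambda>x. exp (- 1 / x)) has_real_derivative exp (- 1 / x) * (- (- 1) * (1 / x)\<^sup>2)) (at x)"
        by (rule DERIV_chain2[OF DERIV_exp i])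
      ultimately show ?thesis
        by (rule DERIV_cong[OF DERIV_mult])
          (use 2 in \<open>simp add: flat_fun_def poly_monom power2_eq_square field_simps\<close>)
    qed
    then show ?thesis
      by (rule has_field_derivative_transform_within_open[of _ _ _ "{0<..}"])
        (use 2 in \<open>auto simp: flat_fun_def\<close>)
  next
    case 3
    \<comment> \<open>The difference quotient at 0 is y p(y) exp(-y) with y = 1/h;
      \<open>pCons 0 p\<close> is X p and absorbs the factor 1/h.\<close>
    have "((\<lambda>h. poly (pCons 0 p) (inverse h) / exp (inverse h)) \<longlongrightarrow> 0) (at_right 0)"
      by (rule filterlim_compose[OF tendsto_poly_div_exp filterlim_inverse_at_top_right])
    then have r: "((\<lambda>h. flat_fun p h / h) \<longlongrightarrow> 0) (at_right 0)"
    proof (rule Lim_transform_eventually)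
      have "poly (pCons 0 p) (inverse h) / exp (inverse h) = flat_fun p h / h" if "0 < h" for h
        using that by (simp add: flat_fun_def exp_minus divide_inverse)
      then show "\<forall>\<^sub>F h in at_right 0.
          poly (pCons 0 p) (inverse h) / exp (inverse h) = flat_fun p h / h"
        by (auto simp: eventually_at_filter)
    qed
    have l: "((\<lambda>h. flat_fun p h / h) \<longlongrightarrow> 0) (at_left 0)"
      by (rule Lim_transform_eventually[OF tendsto_const])
        (simp add: eventually_at_filter flat_fun_def)
    have "((\<lambda>h. flat_fun p h / h) \<longlongrightarrow> 0) (at 0)"
      using l r by (simp add: filterlim_split_at)
    then show ?thesis using 3 by (simp add: DERIV_def) (simp add: flat_fun_def)
  qed
qed

lemma smooth_flat_fun: "smooth_fun (flat_fun p)"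
proof -
  have "Ck k (flat_fun p)" for k
  proof (induction k arbitrary: p)
    case 0
    then show ?case
      by (metis Ck.simps(1) DERIV_isCont continuous_at_imp_continuous_on flat_fun_deriv)
  next
    case (Suc k)
    then show ?case unfolding Ck_Suc_real using flat_fun_deriv by blast
  qed
  then show ?thesis by (simp add: smooth_fun_def)
qed

lemma bump_exists:
  fixes c d :: real
  assumes "c < d"
  obtains \<eta> where "smooth_fun \<eta>" "\<And>x. 0 \<le> \<eta> x" "\<And>x. x \<notin> {c<..<d} \<Longrightarrow> \<eta> x = 0"
    "integrable lborel \<eta>" "integral\<^sup>L lborel \<eta> = 1"
proof -
  \<comment> \<open>One factor vanishes left of c, the other right of d. The arguments are spelled
    as m x + c so that \<open>smooth_fun_affine\<close> matches.\<close>
  define \<phi> where "\<phi> x = flat_fun 1 (1 * x + (- c)) * flat_fun 1 ((- 1) * x + d)" for x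
  have sm: "smooth_fun \<phi>"
    unfolding \<phi>_def by (intro smooth_fun_mult smooth_fun_affine smooth_flat_fun)
  have pos: "0 < \<phi> x" if "x \<in> {c<..<d}" for x
    using that by (simp add: \<phi>_def flat_fun_def)
  have zero: "\<phi> x = 0" if "x \<notin> {c<..<d}" for x
    using that by (auto simp: \<phi>_def flat_fun_def)
  have nn: "0 \<le> \<phi> x" for x using pos[of x] zero[of x] by fastforce
  have "set_integrable lborel {c..d} \<phi>"
    by (rule borel_integrable_atLeastAtMost') (rule smooth_fun_continuous[OF sm])
  moreover have "(\<lambda>x. indicator {c..d} x *\<^sub>R \<phi> x) = \<phi>"
  proof
    fix x show "indicator {c..d} x *\<^sub>R \<phi> x = \<phi> x"
      using zero[of x] by (cases "x \<in> {c<..<d}") (auto simp: indicator_def)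
  qed
  ultimately have int: "integrable lborel \<phi>" by (simp add: set_integrable_def)
  have "integral\<^sup>L lborel \<phi> \<noteq> 0"
  proof
    assume "integral\<^sup>L lborel \<phi> = 0"
    then have "AE x in lborel. \<phi> x = 0"
      using integral_nonneg_eq_0_iff_AE[OF int] nn by simp
    then have "AE x in lborel. x \<notin> {c<..<d}" by eventually_elim (use pos in force)
    then have "emeasure lborel {c<..<d} = 0"
      by (subst (asm) AE_iff_measurable[of "{c<..<d}"]) auto
    then show False using assms by simp
  qed
  moreover have "0 \<le> integral\<^sup>L lborel \<phi>" using nn by simp
  ultimately have p: "0 < integral\<^sup>L lborel \<phi>" by simp
  show thesis
  proof (rule that[of "\<lambda>x. \<phi> x * inverse (integral\<^sup>L lborel \<phi>)"])
    show "smooth_fun (\<lambda>x. \<phi> x * inverse (integral\<^sup>L lborel \<phi>))"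
      by (intro smooth_fun_mult sm smooth_fun_const)
  qed (use nn zero int p in auto)
qed


section \<open>Test functions and the fundamental theorem for weak derivatives\<close>

lemma test_fun_intervalI:
  fixes \<phi> :: "real \<Rightarrow> real"
  assumes "smooth_fun \<phi>" "a < c" "d < b" "\<And>x. x \<notin> {c<..<d} \<Longrightarrow> \<phi> x = 0"
  shows "test_fun {a<..<b} \<phi>"
proof -
  have "{x. \<phi> x \<noteq> 0} \<subseteq> {c<..<d}" using assms(4) by blast
  then have "{x. \<phi> x \<noteq> 0} \<subseteq> {c..d}" by fastforce
  then have *: "closure {x. \<phi> x \<noteq> 0} \<subseteq> {c..d}" by (rule closure_minimal) simp
  then have "compact (closure {x. \<phi> x \<noteq> 0})"
    by (meson bounded_closed_interval bounded_subset closed_closure compact_eq_bounded_closed)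
  with * assms show ?thesis unfolding test_fun_def by fastforce
qed

text \<open>Half of the gap between the compact support and each end of (a, b) is left free, so
  \<phi> vanishes at c and d as well.\<close>

lemma test_fun_intervalE:
  fixes \<phi> :: "real \<Rightarrow> real"
  assumes "test_fun {a<..<b} \<phi>" "a < b"
  obtains c d where "a < c" "c < d" "d < b" "\<And>x. x \<notin> {c<..<d} \<Longrightarrow> \<phi> x = 0"
proof -
  \<comment> \<open>The midpoint keeps K nonempty when \<phi> is zero, so that its extrema
    exist.\<close>
  define K where "K = insert ((a + b) / 2) (closure {x. \<phi> x \<noteq> 0})"
  have K: "compact K" "K \<subseteq> {a<..<b}" "K \<noteq> {}"
    using assms by (auto simp: K_def test_fun_def)
  obtain m where m: "m \<in> K" "\<And>x. x \<in> K \<Longrightarrow> m \<le> x" using compact_attains_inf[OF K(1,3)] by auto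
  obtain M where M: "M \<in> K" "\<And>x. x \<in> K \<Longrightarrow> x \<le> M" using compact_attains_sup[OF K(1,3)] by auto
  have ineq: "a < m" "m \<le> M" "M < b" using m M K(2) by auto
  show thesis
  proof (rule that[of "(a + m) / 2" "(M + b) / 2"])
    fix x assume x: "x \<notin> {(a + m) / 2<..<(M + b) / 2}"
    have "x \<notin> K"
    proof
      assume "x \<in> K"
      then have "m \<le> x" "x \<le> M" using m M by auto
      with x ineq show False by (auto simp: field_simps)
    qed
    then show "\<phi> x = 0" using closure_subset[of "{x. \<phi> x \<noteq> 0}"] by (auto simp: K_def)
  qed (use ineq in auto)
qed

lemma test_fun_dir_deriv:
  assumes "test_fun U (\<phi> :: real \<Rightarrow> real)"
  shows "test_fun U (dir_deriv 1 \<phi>)"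
proof -
  let ?S = "{x. \<phi> x \<noteq> 0}" and ?S' = "{x. dir_deriv 1 \<phi> x \<noteq> 0}"
  have "dir_deriv 1 \<phi> x = 0" if "x \<notin> closure ?S" for x
  proof (rule dir_deriv_real)
    have "((\<lambda>x. 0) has_real_derivative 0) (at x)" by simp
    then show "(\<phi> has_real_derivative 0) (at x)"
      by (rule has_field_derivative_transform_within_open[of _ _ _ "- closure ?S"])
        (use that closure_subset[of ?S] in auto)
  qed
  then have sub: "closure ?S' \<subseteq> closure ?S" by (intro closure_minimal) auto
  moreover have "compact (closure ?S')"
    using assms sub unfolding test_fun_def
    by (metis closed_closure compact_Int_closed inf.absorb_iff2)
  ultimately show ?thesis using assms smooth_fun_deriv(2) unfolding test_fun_def by blast
qed

lemma test_fun_funpow: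
  "test_fun U (\<phi> :: real \<Rightarrow> real) \<Longrightarrow> test_fun U ((dir_deriv 1 ^^ k) \<phi>)"
  by (induction k) (auto intro: test_fun_dir_deriv)

lemma loc_integrable_continuous: "continuous_on U f \<Longrightarrow> loc_integrable U f"
  unfolding loc_integrable_def set_integrable_def
  by (auto intro!: borel_integrable_compact intro: continuous_on_subset simp del: real_scaleR_def)

text \<open>The factor \<phi> cuts the integral down to the compact interval [c, d], where g is
  integrable and \<phi> is bounded by continuity.\<close>

lemma loc_integrable_mult:
  fixes g \<phi> :: "real \<Rightarrow> real"
  assumes g: "loc_integrable {a<..<b} g" and cd: "a < c" "d < b"
    and \<phi>: "continuous_on UNIV \<phi>" "\<And>x. x \<notin> {c<..<d} \<Longrightarrow> \<phi> x = 0"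
  shows "set_integrable lborel {a<..<b} (\<lambda>x. g x * \<phi> x)"
proof -
  have "{c..d} \<subseteq> {a<..<b}" using cd by auto
  then have i: "integrable lborel (\<lambda>x. indicator {c..d} x * g x)"
    using g unfolding loc_integrable_def set_integrable_def by auto
  have eq: "(\<lambda>x. indicator {a<..<b} x *\<^sub>R (g x * \<phi> x)) = (\<lambda>x. (indicator {c..d} x * g x) * \<phi> x)"
  proof
    fix x show "indicator {a<..<b} x *\<^sub>R (g x * \<phi> x) = (indicator {c..d} x * g x) * \<phi> x"
      using \<phi>(2)[of x] cd by (cases "x \<in> {c<..<d}") (auto simp: indicator_def)
  qed
  have "compact (\<phi> ` {c..d})"
    using \<phi>(1) by (intro compact_continuous_image) (auto intro: continuous_on_subset)
  then obtain M where M: "\<And>x. x \<in> {c..d} \<Longrightarrow> \<bar>\<phi> x\<bar> \<le> M"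
    unfolding bounded_iff by (meson compact_imp_bounded bounded_real imageI)
  have [measurable]: "\<phi> \<in> borel_measurable borel" using \<phi>(1) by (rule borel_measurable_continuous_onI)
  show ?thesis unfolding set_integrable_def eq
  proof (rule Bochner_Integration.integrable_bound)
    show "integrable lborel (\<lambda>x. M * (indicator {c..d} x * g x))" using i by simp
    show "(\<lambda>x. indicator {c..d} x * g x * \<phi> x) \<in> borel_measurable lborel"
      using borel_measurable_integrable[OF i] by simp
    have "norm (indicator {c..d} x * g x * \<phi> x) \<le> norm (M * (indicator {c..d} x * g x))" for x
    proof (cases "x \<in> {c..d}")
      case True
      then have "\<bar>\<phi> x\<bar> \<le> \<bar>M\<bar>" using M by fastforce
      then show ?thesis using True by (simp add: abs_mult mult.commute mult_right_mono)
    qed simp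
    then show "AE x in lborel. norm (indicator {c..d} x * g x * \<phi> x)
        \<le> norm (M * (indicator {c..d} x * g x))" by simp
  qed
qed

lemma loc_integrable_mult_test_fun:
  fixes g \<phi> :: "real \<Rightarrow> real"
  assumes "loc_integrable {a<..<b} g" "test_fun {a<..<b} \<phi>"
  shows "set_integrable lborel {a<..<b} (\<lambda>x. g x * \<phi> x)"
proof (cases "a < b")
  case True
  then obtain c d where "a < c" "d < b" "\<And>x. x \<notin> {c<..<d} \<Longrightarrow> \<phi> x = 0"
    using test_fun_intervalE[OF assms(2)] by metis
  moreover have "continuous_on UNIV \<phi>"
    using assms(2) smooth_fun_continuous by (auto simp: test_fun_def)
  ultimately show ?thesis using loc_integrable_mult[OF assms(1)] by blast
qed (simp add: set_integrable_def)

lemma primitive_exists: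
  fixes \<phi> :: "real \<Rightarrow> real"
  assumes cont: "continuous_on UNIV \<phi>" and zero: "\<And>x. x \<notin> {c<..<d} \<Longrightarrow> \<phi> x = 0"
  obtains \<Phi> where "\<And>x. (\<Phi> has_real_derivative \<phi> x) (at x)" "\<And>x. x \<le> c \<Longrightarrow> \<Phi> x = 0"
    "\<And>x. d \<le> x \<Longrightarrow> \<Phi> x = integral\<^sup>L lborel \<phi>"
proof -
  have c: "continuous_on S \<phi>" for S using cont by (rule continuous_on_subset) simp
  \<comment> \<open>The base point lies strictly left of c, so every x \<ge> c is interior to {c -
    1..x + 1} and the one-interval derivative is a full one. Left of c the primitive is locally
    zero.\<close>
  define \<Phi> where "\<Phi> x = (LINT t:{c - 1..x}|lborel. \<phi> t)" for x
  have eq: "\<Phi> x = integral {c - 1..x} \<phi>" for x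
    unfolding \<Phi>_def
    by (rule set_borel_integral_eq_integral(2)) (rule borel_integrable_atLeastAtMost'[OF c])
  have 0: "\<Phi> x = 0" if "x \<le> c" for x
  proof -
    have "indicator {c - 1..x} t *\<^sub>R \<phi> t = 0" for t
      using zero[of t] that by (auto simp: indicator_def)
    then have "(\<lambda>t. indicator {c - 1..x} t *\<^sub>R \<phi> t) = (\<lambda>t. 0)" by blast
    then show ?thesis unfolding \<Phi>_def set_lebesgue_integral_def by (simp del: real_scaleR_def)
  qed
  show thesis
  proof (rule that[of \<Phi>])
    show "(\<Phi> has_real_derivative \<phi> x) (at x)" for x
    proof (cases "x < c")
      case True
      have "((\<lambda>x. 0) has_real_derivative 0) (at x)" by simp
      then have "(\<Phi> has_real_derivative 0) (at x)"
        by (rule has_field_derivative_transform_within_open[of _ _ _ "{..<c}"])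
          (use True 0 in auto)
      then show ?thesis using zero[of x] True by simp
    next
      case False
      have "((\<lambda>x. integral {c - 1..x} \<phi>) has_real_derivative \<phi> x) (at x within {c - 1..x + 1})"
        by (rule integral_has_real_derivative) (use c False in auto)
      moreover have "at x within {c - 1..x + 1} = at x"
        by (rule at_within_interior) (use False in auto)
      ultimately show ?thesis by (simp add: eq[abs_def])
    qed
    show "\<Phi> x = integral\<^sup>L lborel \<phi>" if "d \<le> x" for x
    proof -
      have "indicator {c - 1..x} t *\<^sub>R \<phi> t = \<phi> t" for t
        using zero[of t] that by (cases "t \<in> {c<..<d}") (auto simp: indicator_def)
      then have "(\<lambda>t. indicator {c - 1..x} t *\<^sub>R \<phi> t) = \<phi>" by blast
      then show ?thesis unfolding \<Phi>_def set_lebesgue_integral_def by (simp del: real_scaleR_def)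
    qed
  qed (rule 0)
qed

section \<open>One-sided mollifiers and the recovery of point values\<close>

lemma mollifier_sequence:
  fixes x \<delta> :: real
  assumes "0 < \<delta>"
  obtains \<eta> where "\<And>n::nat. smooth_fun (\<eta> n)" "\<And>n t. 0 \<le> \<eta> n t"
    "\<And>n t. t \<notin> {x<..<x + \<delta> / (real n + 1)} \<Longrightarrow> \<eta> n t = 0"
    "\<And>n. integrable lborel (\<eta> n)" "\<And>n. integral\<^sup>L lborel (\<eta> n) = 1"
proof -
  have "\<forall>n::nat. \<exists>\<eta>. smooth_fun \<eta> \<and> (\<forall>t. 0 \<le> \<eta> t) \<and> (\<forall>t. t \<notin> {x<..<x + \<delta> / (real n + 1)} \<longrightarrow> \<eta> t = 0)
      \<and> integrable lborel \<eta> \<and> integral\<^sup>L lborel \<eta> = 1"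
  proof
    fix n :: nat
    have "x < x + \<delta> / (real n + 1)" using assms by simp
    from bump_exists[OF this] show "\<exists>\<eta>. smooth_fun \<eta> \<and> (\<forall>t. 0 \<le> \<eta> t) \<and>
      (\<forall>t. t \<notin> {x<..<x + \<delta> / (real n + 1)} \<longrightarrow> \<eta> t = 0) \<and> integrable lborel \<eta> \<and> integral\<^sup>L lborel \<eta> = 1"
      by metis
  qed
  then show thesis using that by metis
qed

lemma shrinking_support_subset:
  fixes \<delta> :: real assumes "0 < \<delta>" shows "{x<..<x + \<delta> / (real n + 1)} \<subseteq> {x<..<x + \<delta>}"
proof -
  have "\<delta> / (real n + 1) \<le> \<delta>" using assms by (simp add: field_simps)
  then show ?thesis by auto
qed

text \<open>Since \<eta> n is nonnegative with mass one, the integral is a weighted mean of f. It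
  differs from f x by at most the oscillation of f on the support, which shrinks to x from the
  right.\<close>

lemma mollifier_limit:
  fixes f :: "real \<Rightarrow> real"
  assumes f: "continuous_on {a<..<b} f" and x: "a < x" "x + \<delta> < b" "0 < \<delta>"
    and \<eta>: "\<And>n::nat. smooth_fun (\<eta> n)" "\<And>n t. 0 \<le> \<eta> n t"
    "\<And>n t. t \<notin> {x<..<x + \<delta> / (real n + 1)} \<Longrightarrow> \<eta> n t = 0"
    "\<And>n. integrable lborel (\<eta> n)" "\<And>n. integral\<^sup>L lborel (\<eta> n) = 1"
  shows "(\<lambda>n. LINT t:{a<..<b}|lborel. f t * \<eta> n t) \<longlonglongrightarrow> f x"
proof (rule LIMSEQ_I)
  fix e :: real assume e: "0 < e"
  have "isCont f x" using f x by (simp add: continuous_on_eq_continuous_at)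
  then obtain r where r: "0 < r" "\<And>t. \<bar>t - x\<bar> < r \<Longrightarrow> \<bar>f t - f x\<bar> < e / 2"
    unfolding continuous_at_real_range real_norm_def using e by (metis half_gt_zero)
  obtain N :: nat where N: "\<delta> / r < N" using reals_Archimedean2 by blast
  show "\<exists>N. \<forall>n\<ge>N. norm ((LINT t:{a<..<b}|lborel. f t * \<eta> n t) - f x) < e"
  proof (intro exI allI impI)
    fix n assume "N \<le> n"
    then have "\<delta> / r < real n + 1" using N by linarith
    then have small: "\<delta> / (real n + 1) < r" using r(1) by (simp add: field_simps)
    have "\<eta> n t = 0" if "t \<notin> {x<..<x + \<delta>}" for t
      using \<eta>(3)[of t n] that shrinking_support_subset[OF x(3), of x n] by blast
    then have int: "set_integrable lborel {a<..<b} (\<lambda>t. f t * \<eta> n t)"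
      by (rule loc_integrable_mult[OF loc_integrable_continuous[OF f] x(1,2) smooth_fun_continuous[OF \<eta>(1)]])
    have pt: "\<bar>indicator {a<..<b} t *\<^sub>R (f t * \<eta> n t) - f x * \<eta> n t\<bar> \<le> e / 2 * \<eta> n t" for t
    proof (cases "t \<in> {x<..<x + \<delta> / (real n + 1)}")
      case True
      then have t: "t \<in> {a<..<b}" "\<bar>t - x\<bar> < r"
        using x small shrinking_support_subset[OF x(3), of x n] by auto
      have "indicator {a<..<b} t *\<^sub>R (f t * \<eta> n t) - f x * \<eta> n t = (f t - f x) * \<eta> n t"
        using t by (simp add: algebra_simps)
      then show ?thesis using mult_right_mono[OF less_imp_le[OF r(2)[OF t(2)]] \<eta>(2)[of n t]] \<eta>(2)[of n t]
        by (simp add: abs_mult)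
    qed (simp add: \<eta>(3))
    have "(LINT t:{a<..<b}|lborel. f t * \<eta> n t) - f x
        = (LINT t|lborel. indicator {a<..<b} t *\<^sub>R (f t * \<eta> n t) - f x * \<eta> n t)"
      using int \<eta>(4,5) by (simp add: set_lebesgue_integral_def set_integrable_def)
    then have "\<bar>(LINT t:{a<..<b}|lborel. f t * \<eta> n t) - f x\<bar>
        \<le> (LINT t|lborel. \<bar>indicator {a<..<b} t *\<^sub>R (f t * \<eta> n t) - f x * \<eta> n t\<bar>)"
      by (simp only: integral_abs_bound)
    also have "\<dots> \<le> (LINT t|lborel. e / 2 * \<eta> n t)"
      using int \<eta>(4) by (intro integral_mono pt)
        (auto simp: set_integrable_def intro!: integrable_abs)
    also have "\<dots> < e" using \<eta>(5) e by simp
    finally show "norm ((LINT t:{a<..<b}|lborel. f t * \<eta> n t) - f x) < e" by simp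
  qed
qed

lemma has_weak_deriv_real_1:
  "has_weak_deriv (1::real) 1 U f g \<longleftrightarrow> loc_integrable U f \<and> loc_integrable U g \<and>
     (\<forall>\<phi>. test_fun U \<phi> \<longrightarrow>
        (LINT x:U|lborel. f x * dir_deriv 1 \<phi> x) = - (LINT x:U|lborel. g x * \<phi> x))"
  by (simp add: has_weak_deriv_def)

text \<open>Tested against smooth approximations of the indicator of \<open>{c<..d}\<close>, whose derivatives are
  mollifiers at \<open>c\<close> and \<open>d\<close>.\<close>

lemma weak_deriv_FTC:
  fixes f g :: "real \<Rightarrow> real"
  assumes f: "continuous_on {a<..<b} f" and w: "has_weak_deriv 1 1 {a<..<b} f g"
    and cd: "a < c" "c < d" "d < b"
  shows "(LINT x:{c<..d}|lborel. g x) = f d - f c"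
proof -
  \<comment> \<open>The mollifiers sit to the right of their base point; \<delta> is room for them
    right of d inside (a, b), and a fortiori right of c.\<close>
  define \<delta> where "\<delta> = (b - d) / 2"
  have \<delta>: "0 < \<delta>" "d + \<delta> < b" "c + \<delta> < b" using cd by (auto simp: \<delta>_def field_simps)
  have step: "\<exists>\<eta> E. (\<lambda>n. LINT t:{a<..<b}|lborel. f t * \<eta> n t) \<longlonglongrightarrow> f x \<and>
      (\<forall>n. smooth_fun (\<eta> n) \<and> (\<forall>t. t \<notin> {x<..<x + \<delta>} \<longrightarrow> \<eta> n t = 0) \<and>
        (\<forall>t. (E n has_real_derivative \<eta> n t) (at t)) \<and> (\<forall>t. 0 \<le> E n t \<and> E n t \<le> 1) \<and>
        (\<forall>t\<le>x. E n t = 0) \<and> (\<forall>t\<ge>x + \<delta> / (real n + 1). E n t = 1))"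
    if x: "a < x" "x + \<delta> < b" for x
  proof -
    obtain \<eta> where \<eta>: "\<And>n::nat. smooth_fun (\<eta> n)" "\<And>n t. 0 \<le> \<eta> n t"
      "\<And>n t. t \<notin> {x<..<x + \<delta> / (real n + 1)} \<Longrightarrow> \<eta> n t = 0"
      "\<And>n. integrable lborel (\<eta> n)" "\<And>n. integral\<^sup>L lborel (\<eta> n) = 1"
      using mollifier_sequence[OF \<delta>(1), of x] by blast
    have "\<exists>E. (\<forall>t. (E has_real_derivative \<eta> n t) (at t)) \<and> (\<forall>t\<le>x. E t = 0) \<and>
        (\<forall>t\<ge>x + \<delta> / (real n + 1). E t = 1)" for n
      using primitive_exists[OF smooth_fun_continuous[OF \<eta>(1)[of n]] \<eta>(3)[where n = n]] \<eta>(5)[of n]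
      by metis
    then obtain E where E: "\<And>n t. (E n has_real_derivative \<eta> n t) (at t)" "\<And>n t. t \<le> x \<Longrightarrow> E n t = 0"
        "\<And>n t. x + \<delta> / (real n + 1) \<le> t \<Longrightarrow> E n t = 1"
      by metis
    have mono: "E n s \<le> E n t" if "s \<le> t" for n s t
      by (rule DERIV_nonneg_imp_nondecreasing[OF that]) (use E(1) \<eta>(2) in blast)
    have "0 \<le> E n t \<and> E n t \<le> 1" for n t
      using mono[of "min t x" t n] mono[of t "max t (x + \<delta> / (real n + 1))" n] E(2,3) by simp
    moreover have "\<eta> n t = 0" if "t \<notin> {x<..<x + \<delta>}" for n t
      using \<eta>(3)[of t n] that shrinking_support_subset[OF \<delta>(1), of x n] by blast
    moreover have "(\<lambda>n. LINT t:{a<..<b}|lborel. f t * \<eta> n t) \<longlonglongrightarrow> f x"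
      by (rule mollifier_limit[OF f x \<delta>(1)]) (use \<eta> in auto)
    ultimately show ?thesis
      using \<eta>(1) E by (intro exI[of _ \<eta>] exI[of _ E]) auto
  qed
  obtain \<eta> E where \<eta>: "(\<lambda>n. LINT t:{a<..<b}|lborel. f t * \<eta> n t) \<longlonglongrightarrow> f c"
      "\<And>n. smooth_fun (\<eta> n)" "\<And>n t. t \<notin> {c<..<c + \<delta>} \<Longrightarrow> \<eta> n t = 0"
      "\<And>n t. (E n has_real_derivative \<eta> n t) (at t)" "\<And>n t. 0 \<le> E n t \<and> E n t \<le> 1"
      "\<And>n t. t \<le> c \<Longrightarrow> E n t = 0" "\<And>n t. c + \<delta> / (real n + 1) \<le> t \<Longrightarrow> E n t = 1"
    using step[OF cd(1) \<delta>(3)] by blast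
  have ad: "a < d" using cd by simp
  obtain \<theta> F where \<theta>: "(\<lambda>n. LINT t:{a<..<b}|lborel. f t * \<theta> n t) \<longlonglongrightarrow> f d"
      "\<And>n. smooth_fun (\<theta> n)" "\<And>n t. t \<notin> {d<..<d + \<delta>} \<Longrightarrow> \<theta> n t = 0"
      "\<And>n t. (F n has_real_derivative \<theta> n t) (at t)" "\<And>n t. 0 \<le> F n t \<and> F n t \<le> 1"
      "\<And>n t. t \<le> d \<Longrightarrow> F n t = 0" "\<And>n t. d + \<delta> / (real n + 1) \<le> t \<Longrightarrow> F n t = 1"
    using step[OF ad \<delta>(2)] by blast
  \<comment> \<open>E and F are smooth steps at c and d. They vanish up to and at their base point
    and are 1 shortly after it, so E - F tends pointwise to the indicator of the half-open {c<..d},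
    endpoints included. The factor -1 fits \<open>smooth_fun_mult\<close>.\<close>
  define \<phi> where "\<phi> n t = E n t + (- 1) * F n t" for n t
  have le: "\<delta> / (real n + 1) \<le> \<delta>" for n using \<delta>(1) by (simp add: field_simps)
  have \<phi>0: "\<phi> n t = 0" if "t \<notin> {c<..<d + \<delta>}" for n t
  proof (cases "t \<le> c")
    case True then show ?thesis using \<eta>(6) \<theta>(6) cd by (simp add: \<phi>_def)
  next
    case False
    then have "d + \<delta> / (real n + 1) \<le> t" "c + \<delta> / (real n + 1) \<le> t" using that le[of n] cd by auto
    then show ?thesis using \<eta>(7) \<theta>(7) by (simp add: \<phi>_def)
  qed
  have \<phi>1: "\<bar>\<phi> n t\<bar> \<le> 1" for n t
    using \<eta>(5)[of n t] \<theta>(5)[of n t] unfolding \<phi>_def by linarith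
  have sm: "smooth_fun (\<phi> n)" for n unfolding \<phi>_def
    by (intro smooth_fun_add smooth_fun_mult smooth_fun_const
        smooth_fun_primitive[OF \<eta>(2,4)] smooth_fun_primitive[OF \<theta>(2,4)])
  have test: "test_fun {a<..<b} (\<phi> n)" for n
    by (rule test_fun_intervalI[OF sm cd(1) \<delta>(2) \<phi>0])
  have dd: "dir_deriv 1 (\<phi> n) t = \<eta> n t - \<theta> n t" for n t
    unfolding \<phi>_def by (rule dir_deriv_real) (auto intro!: derivative_eq_intros \<eta>(4) \<theta>(4))
  have loc: "loc_integrable {a<..<b} f" using f by (rule loc_integrable_continuous)
  \<comment> \<open>Here \<phi>' = \<eta> - \<theta>, so the tested identity turns the integral of g
    \<phi> into a difference of mollified values of f at d and c.\<close>
  have int_eq: "(LINT t:{a<..<b}|lborel. g t * \<phi> n t)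
      = (LINT t:{a<..<b}|lborel. f t * \<theta> n t) - (LINT t:{a<..<b}|lborel. f t * \<eta> n t)" for n
  proof -
    have "set_integrable lborel {a<..<b} (\<lambda>t. f t * \<eta> n t)"
      by (rule loc_integrable_mult[OF loc cd(1) \<delta>(3) smooth_fun_continuous[OF \<eta>(2)] \<eta>(3)])
    moreover have "set_integrable lborel {a<..<b} (\<lambda>t. f t * \<theta> n t)"
      by (rule loc_integrable_mult[OF loc ad \<delta>(2) smooth_fun_continuous[OF \<theta>(2)] \<theta>(3)])
    ultimately have "(LINT t:{a<..<b}|lborel. f t * dir_deriv 1 (\<phi> n) t)
        = (LINT t:{a<..<b}|lborel. f t * \<eta> n t) - (LINT t:{a<..<b}|lborel. f t * \<theta> n t)"
      by (simp add: dd right_diff_distrib)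
    then show ?thesis using w test[of n] by (simp add: has_weak_deriv_real_1[unfolded One_nat_def])
  qed
  have g: "integrable lborel (\<lambda>x. indicator {c..d + \<delta>} x * g x)"
    using w[unfolded has_weak_deriv_def loc_integrable_def set_integrable_def] cd \<delta>
    by (elim conjE allE[of _ "{c..d + \<delta>}"]) auto
  \<comment> \<open>All \<open>\<phi> n\<close> live in [c, d + \<delta>] and are bounded by 1, so
    |g| restricted to this compact interval is an integrable bound.\<close>
  have "(\<lambda>n. LINT t|lborel. (indicator {c..d + \<delta>} t * g t) * \<phi> n t)
      \<longlonglongrightarrow> (LINT t|lborel. (indicator {c..d + \<delta>} t * g t) * indicator {c<..d} t)"
  proof (rule integral_dominated_convergence)
    have [measurable]: "\<phi> n \<in> borel_measurable borel" for n
      by (rule borel_measurable_continuous_onI[OF smooth_fun_continuous[OF sm]])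
    note [measurable] = borel_measurable_integrable[OF g, simplified]
    show "(\<lambda>t. (indicator {c..d + \<delta>} t * g t) * indicator {c<..d} t) \<in> borel_measurable lborel"
      "\<And>n. (\<lambda>t. (indicator {c..d + \<delta>} t * g t) * \<phi> n t) \<in> borel_measurable lborel"
      by measurable
    show "integrable lborel (\<lambda>t. \<bar>indicator {c..d + \<delta>} t * g t\<bar>)" using g by (rule integrable_abs)
    show "AE t in lborel. norm ((indicator {c..d + \<delta>} t * g t) * \<phi> n t) \<le> \<bar>indicator {c..d + \<delta>} t * g t\<bar>" for n
      using \<phi>1[of n] by (intro AE_I2) (simp add: abs_mult mult_left_le)
    have lim: "(\<lambda>n. \<phi> n t) \<longlonglongrightarrow> indicator {c<..d} t" for t
    proof -
      have lim1: "(\<lambda>n. G n t) \<longlonglongrightarrow> indicator {x<..} t"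
        if G0: "\<And>n t. t \<le> x \<Longrightarrow> G n t = 0" and G1: "\<And>n t. x + \<delta> / (real n + 1) \<le> t \<Longrightarrow> G n t = 1"
        for G :: "nat \<Rightarrow> real \<Rightarrow> real" and x
      proof (cases "t \<le> x")
        case True then show ?thesis using G0 by (simp add: indicator_def)
      next
        case False
        obtain N :: nat where N: "\<delta> / (t - x) < N" using reals_Archimedean2 by blast
        have "G n t = 1" if "N \<le> n" for n
        proof -
          have "\<delta> / (t - x) < real n + 1" using N that by linarith
          then have "\<delta> / (real n + 1) < t - x" using False by (simp add: field_simps)
          then show ?thesis by (intro G1) simp
        qed
        then have "\<forall>\<^sub>F n in sequentially. G n t = 1" using eventually_sequentially by blast
        then show ?thesis using False by (auto simp: indicator_def intro: tendsto_eventually)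
      qed
      have "(\<lambda>n. \<phi> n t) \<longlonglongrightarrow> indicator {c<..} t + (- 1) * indicator {d<..} t"
        unfolding \<phi>_def by (intro tendsto_intros lim1 \<eta> \<theta>)
      then show ?thesis using cd by (auto simp: indicator_def split: if_splits)
    qed
    show "AE t in lborel. (\<lambda>n. (indicator {c..d + \<delta>} t * g t) * \<phi> n t)
      \<longlonglongrightarrow> (indicator {c..d + \<delta>} t * g t) * indicator {c<..d} t"
      by (intro AE_I2 tendsto_intros lim)
  qed
  moreover have "(LINT t|lborel. (indicator {c..d + \<delta>} t * g t) * indicator {c<..d} t)
      = (LINT x:{c<..d}|lborel. g x)"
    using \<delta>(1) unfolding set_lebesgue_integral_def
    by (intro Bochner_Integration.integral_cong) (auto simp: indicator_def)
  moreover have "(LINT t|lborel. (indicator {c..d + \<delta>} t * g t) * \<phi> n t)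
      = (LINT t:{a<..<b}|lborel. g t * \<phi> n t)" for n
    unfolding set_lebesgue_integral_def
  proof (intro Bochner_Integration.integral_cong refl)
    fix t show "(indicator {c..d + \<delta>} t * g t) * \<phi> n t = indicator {a<..<b} t *\<^sub>R (g t * \<phi> n t)"
      using \<phi>0[of t n] cd \<delta> by (cases "t \<in> {c<..<d + \<delta>}") (auto simp: indicator_def)
  qed
  ultimately have "(\<lambda>n. (LINT t:{a<..<b}|lborel. f t * \<theta> n t) - (LINT t:{a<..<b}|lborel. f t * \<eta> n t))
      \<longlonglongrightarrow> (LINT x:{c<..d}|lborel. g x)"
    by (simp add: int_eq)
  then show ?thesis using LIMSEQ_unique tendsto_diff[OF \<theta>(1) \<eta>(1)] by blast
qed


section \<open>Functions with a vanishing weak derivative\<close>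

text \<open>Nothing is assumed about f at a and b. The derivative of f \<phi> vanishes outside some
  [c, d] inside (a, b), and the fundamental theorem on [c, d] has no boundary terms because \<phi>
  is 0 at c and d.\<close>

lemma integral_by_parts_test_fun:
  fixes f f' \<phi> :: "real \<Rightarrow> real"
  assumes f: "\<And>x. x \<in> {a<..<b} \<Longrightarrow> (f has_real_derivative f' x) (at x)"
    and f': "continuous_on {a<..<b} f'" and \<phi>: "test_fun {a<..<b} \<phi>"
  shows "(LINT x:{a<..<b}|lborel. f x * dir_deriv 1 \<phi> x) = - (LINT x:{a<..<b}|lborel. f' x * \<phi> x)"
proof (cases "a < b")
  case True
  obtain c d where cd: "a < c" "c < d" "d < b" and zero: "\<And>x. x \<notin> {c<..<d} \<Longrightarrow> \<phi> x = 0"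
    using test_fun_intervalE[OF \<phi> True] by metis
  have sm: "smooth_fun \<phi>" using \<phi> by (simp add: test_fun_def)
  note d\<phi> = smooth_fun_deriv(1)[OF sm]
  have cf: "continuous_on {a<..<b} f"
    using f by (meson DERIV_isCont continuous_at_imp_continuous_on)
  have i: "set_integrable lborel {a<..<b} (\<lambda>x. f x * dir_deriv 1 \<phi> x)"
    "set_integrable lborel {a<..<b} (\<lambda>x. f' x * \<phi> x)"
    using loc_integrable_mult_test_fun[OF loc_integrable_continuous[OF cf] test_fun_dir_deriv[OF \<phi>]]
      loc_integrable_mult_test_fun[OF loc_integrable_continuous[OF f'] \<phi>] .
  define F where "F x = f' x * \<phi> x + f x * dir_deriv 1 \<phi> x" for x
  have F0: "F x = 0" if "x \<notin> {c..d}" for x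
  proof -
    have "((\<lambda>x. 0) has_real_derivative 0) (at x)" by simp
    then have "(\<phi> has_real_derivative 0) (at x)"
      by (rule has_field_derivative_transform_within_open[of _ _ _ "- {c..d}"])
        (use that in \<open>auto simp: zero\<close>)
    then have "dir_deriv 1 \<phi> x = 0" by (rule dir_deriv_real)
    moreover have "\<phi> x = 0" using that by (intro zero) auto
    ultimately show ?thesis by (simp add: F_def)
  qed
  have sub: "{c..d} \<subseteq> {a<..<b}" using cd by auto
  have "(LINT x:{a<..<b}|lborel. f x * dir_deriv 1 \<phi> x) + (LINT x:{a<..<b}|lborel. f' x * \<phi> x)
      = (LINT x:{a<..<b}|lborel. F x)"
    using i by (simp add: F_def add.commute)
  also have "\<dots> = (LINT x|lborel. indicator {c..d} x *\<^sub>R F x)"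
    unfolding set_lebesgue_integral_def
  proof (intro Bochner_Integration.integral_cong refl)
    fix x show "indicator {a<..<b} x *\<^sub>R F x = indicator {c..d} x *\<^sub>R F x"
      using F0[of x] sub by (cases "x \<in> {c..d}") (auto simp: indicator_def)
  qed
  also have "\<dots> = f d * \<phi> d - f c * \<phi> c"
  proof (rule integral_FTC_atLeastAtMost)
    show "continuous_on {c..d} F" unfolding F_def
      using continuous_on_subset[OF f' sub] continuous_on_subset[OF cf sub]
      by (intro continuous_intros smooth_fun_continuous[OF sm]
          smooth_fun_continuous[OF smooth_fun_deriv(2)[OF sm]])
    fix x assume "c \<le> x" "x \<le> d"
    then have "x \<in> {a<..<b}" using sub by auto
    then have "((\<lambda>x. f x * \<phi> x) has_real_derivative F x) (at x)"
      unfolding F_def by (auto intro!: derivative_eq_intros f d\<phi>)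
    then show "((\<lambda>x. f x * \<phi> x) has_vector_derivative F x) (at x within {c..d})"
      by (simp add: has_real_derivative_iff_has_vector_derivative has_vector_derivative_at_within)
  qed (use cd in simp)
  finally show ?thesis using zero[of c] zero[of d] by simp
qed (simp add: set_lebesgue_integral_def)

section \<open>Test functions of zero mean and the du Bois-Reymond lemma\<close>

lemma test_fun_combination:
  fixes \<phi> \<psi> :: "real \<Rightarrow> real"
  assumes "test_fun {a<..<b} \<phi>" "test_fun {a<..<b} \<psi>" "a < b"
  shows "test_fun {a<..<b} (\<lambda>x. \<phi> x + k * \<psi> x)"
proof -
  obtain c d where 1: "a < c" "d < b" "\<And>x. x \<notin> {c<..<d} \<Longrightarrow> \<phi> x = 0"
    using test_fun_intervalE[OF assms(1,3)] by metis
  obtain c' d' where 2: "a < c'" "d' < b" "\<And>x. x \<notin> {c'<..<d'} \<Longrightarrow> \<psi> x = 0"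
    using test_fun_intervalE[OF assms(2,3)] by metis
  show ?thesis
  proof (rule test_fun_intervalI[of _ _ "min c c'" "max d d'"])
    show "smooth_fun (\<lambda>x. \<phi> x + k * \<psi> x)"
      using assms by (intro smooth_fun_add smooth_fun_mult smooth_fun_const) (auto simp: test_fun_def)
    fix x assume x: "x \<notin> {min c c'<..<max d d'}"
    then have "x \<notin> {c<..<d}" "x \<notin> {c'<..<d'}" by auto
    then show "\<phi> x + k * \<psi> x = 0" using 1(3) 2(3) by simp
  qed (use 1 2 in auto)
qed

lemma dir_deriv_combination:
  fixes \<phi> \<psi> :: "real \<Rightarrow> real"
  assumes "smooth_fun \<phi>" "smooth_fun \<psi>"
  shows "dir_deriv 1 (\<lambda>x. \<phi> x + k * \<psi> x) = (\<lambda>x. dir_deriv 1 \<phi> x + k * dir_deriv 1 \<psi> x)"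
  by (rule ext, rule dir_deriv_real)
    (auto intro!: derivative_eq_intros smooth_fun_deriv(1) assms)

lemma dir_deriv_funpow_combination:
  fixes \<phi> \<psi> :: "real \<Rightarrow> real"
  assumes "smooth_fun \<phi>" "smooth_fun \<psi>"
  shows "(dir_deriv 1 ^^ n) (\<lambda>x. \<phi> x + k * \<psi> x)
      = (\<lambda>x. (dir_deriv 1 ^^ n) \<phi> x + k * (dir_deriv 1 ^^ n) \<psi> x)"
proof -
  have sm: "smooth_fun ((dir_deriv 1 ^^ n) f)" if "smooth_fun f" for n and f :: "real \<Rightarrow> real"
    using that by (induction n) (auto intro: smooth_fun_deriv(2))
  show ?thesis
    by (induction n) (simp_all add: dir_deriv_combination sm assms)
qed

lemma test_fun_integrable:
  fixes \<phi> :: "real \<Rightarrow> real"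
  assumes "test_fun {a<..<b} \<phi>"
  shows "integrable lborel \<phi>" "(LINT x:{a<..<b}|lborel. \<phi> x) = integral\<^sup>L lborel \<phi>"
proof -
  have "set_integrable lborel {a<..<b} (\<lambda>x. 1 * \<phi> x)"
    by (rule loc_integrable_mult_test_fun[OF loc_integrable_continuous assms]) simp
  moreover have "indicator {a<..<b} x *\<^sub>R \<phi> x = \<phi> x" for x
    using assms closure_subset[of "{x. \<phi> x \<noteq> 0}"] by (auto simp: test_fun_def indicator_def)
  then have "(\<lambda>x. indicator {a<..<b} x *\<^sub>R \<phi> x) = \<phi>" by blast
  ultimately show "integrable lborel \<phi>" "(LINT x:{a<..<b}|lborel. \<phi> x) = integral\<^sup>L lborel \<phi>"
    by (simp_all add: set_integrable_def set_lebesgue_integral_def del: real_scaleR_def)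
qed

text \<open>The primitive that is zero left of the support equals the total integral right of it;
  zero mean is thus what makes it compactly supported.\<close>

lemma test_fun_primitive:
  fixes \<phi> :: "real \<Rightarrow> real"
  assumes \<phi>: "test_fun {a<..<b} \<phi>" and ab: "a < b" and 0: "integral\<^sup>L lborel \<phi> = 0"
  obtains \<Phi> where "test_fun {a<..<b} \<Phi>" "dir_deriv 1 \<Phi> = \<phi>"
proof -
  obtain c d where cd: "a < c" "c < d" "d < b" and zero: "\<And>x. x \<notin> {c<..<d} \<Longrightarrow> \<phi> x = 0"
    using test_fun_intervalE[OF \<phi> ab] by metis
  have sm: "smooth_fun \<phi>" using \<phi> by (simp add: test_fun_def)
  obtain \<Phi> where \<Phi>: "\<And>x. (\<Phi> has_real_derivative \<phi> x) (at x)" "\<And>x. x \<le> c \<Longrightarrow> \<Phi> x = 0"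
    "\<And>x. d \<le> x \<Longrightarrow> \<Phi> x = 0"
    using primitive_exists[OF smooth_fun_continuous[OF sm] zero] 0 by metis
  show thesis
  proof (rule that)
    have "\<Phi> x = 0" if "x \<notin> {c<..<d}" for x using that \<Phi>(2,3)[of x] by force
    then show "test_fun {a<..<b} \<Phi>"
      by (rule test_fun_intervalI[OF smooth_fun_primitive[OF sm \<Phi>(1)] cd(1,3)])
    show "dir_deriv 1 \<Phi> = \<phi>" using dir_deriv_real[OF \<Phi>(1)] by blast
  qed
qed

text \<open>Du Bois-Reymond: a functional that vanishes on all derivatives is a multiple of the integral,
  because \<open>\<phi> - (\<integral>\<phi>) w\<close> is a derivative when \<open>\<integral>w = 1\<close>.\<close>

lemma annihilator_of_derivatives:
  fixes T :: "(real \<Rightarrow> real) \<Rightarrow> real"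
  assumes ab: "a < b"
    and lin: "\<And>\<phi> \<psi> k. test_fun {a<..<b} \<phi> \<Longrightarrow> test_fun {a<..<b} \<psi> \<Longrightarrow> T (\<lambda>x. \<phi> x + k * \<psi> x) = T \<phi> + k * T \<psi>"
    and T0: "\<And>\<phi>. test_fun {a<..<b} \<phi> \<Longrightarrow> T (dir_deriv 1 \<phi>) = 0"
  shows "\<exists>c. \<forall>\<phi>. test_fun {a<..<b} \<phi> \<longrightarrow> T \<phi> = c * integral\<^sup>L lborel \<phi>"
proof -
  \<comment> \<open>The middle third keeps the bump w away from both ends of (a, b). The constant
    sought is T w.\<close>
  define m M where "m = (2 * a + b) / 3" and "M = (a + 2 * b) / 3"
  have mM: "a < m" "m < M" "M < b" using ab by (auto simp: m_def M_def)
  obtain w where w: "smooth_fun w" "\<And>x. x \<notin> {m<..<M} \<Longrightarrow> w x = 0" "integral\<^sup>L lborel w = 1"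
    using bump_exists[OF mM(2)] by metis
  have tw: "test_fun {a<..<b} w" by (rule test_fun_intervalI[OF w(1) mM(1,3) w(2)])
  have "T \<phi> = T w * integral\<^sup>L lborel \<phi>" if \<phi>: "test_fun {a<..<b} \<phi>" for \<phi>
  proof -
    let ?k = "- integral\<^sup>L lborel \<phi>"
    have t: "test_fun {a<..<b} (\<lambda>x. \<phi> x + ?k * w x)" by (rule test_fun_combination[OF \<phi> tw ab])
    have "integral\<^sup>L lborel (\<lambda>x. \<phi> x + ?k * w x) = 0"
      using test_fun_integrable(1)[OF \<phi>] test_fun_integrable(1)[OF tw] w(3) by simp
    then obtain \<Phi> where "test_fun {a<..<b} \<Phi>" "dir_deriv 1 \<Phi> = (\<lambda>x. \<phi> x + ?k * w x)"
      using test_fun_primitive[OF t ab] by metis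
    then have "T (\<lambda>x. \<phi> x + ?k * w x) = 0" using T0 by metis
    then show ?thesis using lin[OF \<phi> tw, of ?k] by (simp add: mult.commute)
  qed
  then show ?thesis by blast
qed

lemma funpow_pderiv_integral_by_parts:
  fixes q :: "real poly"
  assumes "test_fun {a<..<b} \<phi>"
  shows "(LINT x:{a<..<b}|lborel. poly q x * (dir_deriv 1 ^^ k) \<phi> x)
      = (-1) ^ k * (LINT x:{a<..<b}|lborel. poly ((pderiv ^^ k) q) x * \<phi> x)"
proof (induction k arbitrary: q)
  case (Suc k)
  have "(LINT x:{a<..<b}|lborel. poly q x * (dir_deriv 1 ^^ Suc k) \<phi> x)
      = - (LINT x:{a<..<b}|lborel. poly (pderiv q) x * (dir_deriv 1 ^^ k) \<phi> x)"
    unfolding funpow.simps o_apply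
    by (rule integral_by_parts_test_fun)
      (auto intro!: poly_DERIV test_fun_funpow assms continuous_intros)
  then show ?case by (simp add: Suc funpow_swap1)
qed simp

text \<open>The witness is c X^k / k!, the factorial being written as a Pochhammer symbol. In the
  inner induction the coefficient is arbitrary, so that it can absorb the factor produced by each
  differentiation.\<close>

lemma funpow_pderiv_eq_const: "\<exists>q::real poly. degree q \<le> k \<and> (pderiv ^^ k) q = [:c:]"
proof (induction k arbitrary: c)
  case 0
  show ?case by (intro exI[of _ "[:c:]"]) simp
next
  case (Suc k)
  have *: "(pderiv ^^ j) (monom x (j + i)) = monom (x * pochhammer (real i + 1) j) i" for x :: real and i j
  proof (induction j arbitrary: x)
    case (Suc j)
    then show ?case
      by (simp add: funpow_swap1 pderiv_monom pochhammer_Suc algebra_simps)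
  qed simp
  show ?case
    using *[where x = "c / pochhammer 1 (Suc k)" and i = 0 and j = "Suc k"]
    by (intro exI[of _ "monom (c / pochhammer 1 (Suc k)) (Suc k)"])
      (simp add: degree_monom_le monom_0 pochhammer_fact[symmetric])
qed

text \<open>Order 0 is the fundamental lemma: integrals against mollifiers at x vanish and tend to f
  x. For order k + 1, the functional \<phi> \<mapsto> \<integral> f \<phi>^(k) kills derivatives and
  is therefore c \<integral> \<phi>; subtracting a polynomial of degree at most k that induces the
  same functional lowers the order. The disjunct p = 0 is needed since the zero polynomial has
  degree 0, which is not below k = 0.\<close>

lemma weak_deriv_zero_imp_poly:
  fixes f :: "real \<Rightarrow> real"
  assumes ab: "a < b" and f: "continuous_on {a<..<b} f"
    and weak: "\<And>\<phi>. test_fun {a<..<b} \<phi> \<Longrightarrow> (LINT x:{a<..<b}|lborel. f x * (dir_deriv 1 ^^ k) \<phi> x) = 0"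
  shows "\<exists>p. (\<forall>x\<in>{a<..<b}. f x = poly p x) \<and> (p = 0 \<or> degree p < k)"
  using f weak
proof (induction k arbitrary: f)
  case 0
  have "f x = 0" if x: "x \<in> {a<..<b}" for x
  proof -
    define \<delta> where "\<delta> = (b - x) / 2"
    have \<delta>: "0 < \<delta>" "x + \<delta> < b" using x by (auto simp: \<delta>_def field_simps)
    obtain \<eta> where \<eta>: "\<And>n::nat. smooth_fun (\<eta> n)" "\<And>n t. 0 \<le> \<eta> n t"
      "\<And>n t. t \<notin> {x<..<x + \<delta> / (real n + 1)} \<Longrightarrow> \<eta> n t = 0"
      "\<And>n. integrable lborel (\<eta> n)" "\<And>n. integral\<^sup>L lborel (\<eta> n) = 1"
      using mollifier_sequence[OF \<delta>(1), of x] by blast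
    have "\<eta> n t = 0" if "t \<notin> {x<..<x + \<delta>}" for n t
      using \<eta>(3)[of t n] that shrinking_support_subset[OF \<delta>(1), of x n] by blast
    then have "test_fun {a<..<b} (\<eta> n)" for n
      using x \<delta> by (intro test_fun_intervalI[OF \<eta>(1), of a x "x + \<delta>"]) auto
    then have "(LINT t:{a<..<b}|lborel. f t * \<eta> n t) = 0" for n using 0(2)[of "\<eta> n"] by simp
    moreover have "(\<lambda>n. LINT t:{a<..<b}|lborel. f t * \<eta> n t) \<longlonglongrightarrow> f x"
      by (rule mollifier_limit[OF 0(1)]) (use x \<delta> \<eta> in auto)
    ultimately show ?thesis by (simp add: LIMSEQ_const_iff)
  qed
  then show ?case by (intro exI[of _ 0]) simp
next
  case (Suc k)
  let ?I = "\<lambda>f \<phi>. LINT x:{a<..<b}|lborel. f x * \<phi> x"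
  have int: "set_integrable lborel {a<..<b} (\<lambda>x. g x * (dir_deriv 1 ^^ k) \<phi> x)"
    if "continuous_on {a<..<b} g" "test_fun {a<..<b} \<phi>" for g \<phi>
    by (rule loc_integrable_mult_test_fun[OF loc_integrable_continuous test_fun_funpow]) (fact that)+
  have "\<exists>c. \<forall>\<phi>. test_fun {a<..<b} \<phi> \<longrightarrow> ?I f ((dir_deriv 1 ^^ k) \<phi>) = c * integral\<^sup>L lborel \<phi>"
  proof (rule annihilator_of_derivatives[OF ab])
    fix \<phi> \<psi> :: "real \<Rightarrow> real" and m
    assume t: "test_fun {a<..<b} \<phi>" "test_fun {a<..<b} \<psi>"
    then have "smooth_fun \<phi>" "smooth_fun \<psi>" by (auto simp: test_fun_def)
    from dir_deriv_funpow_combination[OF this]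
    have "?I f ((dir_deriv 1 ^^ k) (\<lambda>x. \<phi> x + m * \<psi> x))
       = (LINT x:{a<..<b}|lborel. f x * (dir_deriv 1 ^^ k) \<phi> x + m * (f x * (dir_deriv 1 ^^ k) \<psi> x))"
      by (simp add: algebra_simps)
    also have "\<dots> = ?I f ((dir_deriv 1 ^^ k) \<phi>) + m * ?I f ((dir_deriv 1 ^^ k) \<psi>)"
      using int[OF Suc.prems(1) t(1)] int[OF Suc.prems(1) t(2)] by simp
    finally show "?I f ((dir_deriv 1 ^^ k) (\<lambda>x. \<phi> x + m * \<psi> x))
        = ?I f ((dir_deriv 1 ^^ k) \<phi>) + m * ?I f ((dir_deriv 1 ^^ k) \<psi>)" .
  next
    fix \<phi> :: "real \<Rightarrow> real" assume "test_fun {a<..<b} \<phi>"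
    from Suc.prems(2)[OF this] show "?I f ((dir_deriv 1 ^^ k) (dir_deriv 1 \<phi>)) = 0"
      by (simp add: funpow_swap1)
  qed
  then obtain c where c: "\<And>\<phi>. test_fun {a<..<b} \<phi> \<Longrightarrow>
      ?I f ((dir_deriv 1 ^^ k) \<phi>) = c * integral\<^sup>L lborel \<phi>" by blast
  \<comment> \<open>The sign cancels the (-1)^k from integrating by parts k times.\<close>
  obtain q :: "real poly" where q: "degree q \<le> k" "(pderiv ^^ k) q = [:(-1) ^ k * c:]"
    using funpow_pderiv_eq_const by blast
  have cq: "continuous_on {a<..<b} (poly q)" by (intro continuous_intros)
  have "\<exists>p. (\<forall>x\<in>{a<..<b}. f x - poly q x = poly p x) \<and> (p = 0 \<or> degree p < k)"
  proof (rule Suc.IH)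
    show "continuous_on {a<..<b} (\<lambda>x. f x - poly q x)"
      by (intro continuous_intros Suc.prems)
    fix \<phi> :: "real \<Rightarrow> real" assume \<phi>: "test_fun {a<..<b} \<phi>"
    have "?I (poly q) ((dir_deriv 1 ^^ k) \<phi>) = (-1) ^ k * ((-1) ^ k * c) * integral\<^sup>L lborel \<phi>"
      using funpow_pderiv_integral_by_parts[OF \<phi>, of q k] test_fun_integrable(2)[OF \<phi>]
      by (simp add: q mult.assoc)
    also have "\<dots> = c * integral\<^sup>L lborel \<phi>"
      by (simp flip: mult.assoc power_mult_distrib)
    finally have "?I (poly q) ((dir_deriv 1 ^^ k) \<phi>) = c * integral\<^sup>L lborel \<phi>" .
    then show "?I (\<lambda>x. f x - poly q x) ((dir_deriv 1 ^^ k) \<phi>) = 0"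
      using c[OF \<phi>] int[OF Suc.prems(1) \<phi>] int[OF cq \<phi>] by (simp add: left_diff_distrib)
  qed
  then obtain p where "\<And>x. x \<in> {a<..<b} \<Longrightarrow> f x - poly q x = poly p x" "p = 0 \<or> degree p < k" by blast
  then show ?case using q(1)
    by (intro exI[of _ "p + q"]) (auto simp: algebra_simps less_Suc_eq_le intro!: degree_add_le)
qed


section \<open>Weak convergence in \<open>L\<^sup>2\<close>\<close>

lemma Int_stable_Ioc: "Int_stable (range (\<lambda>(a, b). {a<..b::'a::linorder}))"
proof (rule Int_stableI)
  fix A B assume "A \<in> range (\<lambda>(a, b). {a<..b::'a})" "B \<in> range (\<lambda>(a, b). {a<..b::'a})"
  then obtain a b c d where "A = {a<..b}" "B = {c<..d}" by auto
  then have "A \<inter> B = {max a c<..min b d}" by auto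
  then show "A \<inter> B \<in> range (\<lambda>(a, b). {a<..b})"
    by (intro image_eqI[of _ _ "(max a c, min b d)"]) auto
qed

text \<open>The Borel sets over which h integrates to 0 form a Dynkin system, complements being
  covered by the vanishing total integral. Half-open intervals are an intersection-stable generator
  of the Borel sets, and a density with all integrals zero vanishes a.e.\<close>

lemma AE_zero_if_interval_integrals_zero:
  fixes h :: "real \<Rightarrow> real"
  assumes int: "integrable lborel h" and tot: "integral\<^sup>L lborel h = 0"
    and ivl: "\<And>c d. c < d \<Longrightarrow> (LINT x:{c<..d}|lborel. h x) = 0"
  shows "AE x in lborel. h x = 0"
proof (rule sigma_finite_measure.density_zero[OF lborel.sigma_finite_measure_axioms int])
  fix A :: "real set" assume "A \<in> sets lborel"
  then have "A \<in> sigma_sets UNIV (range (\<lambda>(a, b). {a<..b::real}))"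
    by (simp add: borel_sigma_sets_Ioc)
  have si: "set_integrable lborel A h" if "A \<in> sets borel" for A
    using that int by (simp add: set_integrable_def integrable_mult_indicator del: real_scaleR_def)
  have borel: "A \<in> sets borel" if "A \<in> sigma_sets UNIV (range (\<lambda>(a, b). {a<..b::real}))" for A
    using that by (simp add: borel_sigma_sets_Ioc)
  have "range (\<lambda>(a, b). {a<..b::real}) \<subseteq> Pow UNIV" by simp
  from Int_stable_Ioc this \<open>A \<in> sigma_sets _ _\<close> show "(LINT x:A|lborel. h x) = 0"
  proof (induction rule: sigma_sets_induct_disjoint)
    case (basic A)
    then obtain c d where "A = {c<..d}" by auto
    then show ?case using ivl[of c d] by (cases "c < d") (auto simp: set_lebesgue_integral_def)
  next
    case (compl A)
    have "(LINT x:UNIV - A|lborel. h x) = (LINT x|lborel. h x - indicator A x *\<^sub>R h x)"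
      unfolding set_lebesgue_integral_def
      by (intro Bochner_Integration.integral_cong) (auto simp: indicator_def)
    also have "\<dots> = 0"
      using si[OF borel[OF compl(1)]] compl(2) int tot
      by (simp add: set_integrable_def set_lebesgue_integral_def)
    finally show ?case .
  next
    case (union A)
    have "(LINT x:(\<Union>i. A i)|lborel. h x) = (\<Sum>i. LINT x:A i|lborel. h x)"
    proof (rule lebesgue_integral_countable_add)
      show m: "A i \<in> sets lborel" for i using union(2) borel[of "A i"] by auto
      then show "set_integrable lborel (\<Union>i. A i) h" by (intro si) auto
      show "A i \<inter> A j = {}" if "i \<noteq> j" for i j
        using union(1) that by (auto simp: disjoint_family_on_def)
    qed
    then show ?case using union by simp
  qed (auto simp: set_lebesgue_integral_def)
qed

text \<open>Local integrability and interval hypotheses give information only at a distance from a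
  and b. These intervals lie in compact subsets of (a, b) and fill it up; the first ones may be
  empty.\<close>

lemma interval_exhaustion:
  fixes a b x :: real
  shows "(\<lambda>n. indicator {a + 1 / (real n + 1)<..b - 1 / (real n + 1)} x :: real) \<longlonglongrightarrow> indicator {a<..<b} x"
proof (cases "x \<in> {a<..<b}")
  case True
  have l: "(\<lambda>n. 1 / (real n + 1)) \<longlonglongrightarrow> 0" by real_asymp
  have "\<forall>\<^sub>F n in sequentially. 1 / (real n + 1) < min (x - a) (b - x)"
    by (rule order_tendstoD(2)[OF l]) (use True in auto)
  then have "\<forall>\<^sub>F n in sequentially. indicator {a + 1 / (real n + 1)<..b - 1 / (real n + 1)} x = (1::real)"
    by eventually_elim (auto simp: indicator_def)
  then show ?thesis using True by (simp add: tendsto_eventually)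
next
  case False
  have "indicator {a + 1 / (real n + 1)<..b - 1 / (real n + 1)} x = (0::real)" for n
  proof -
    have "indicator {a + r<..b - r} x = (0::real)" if "0 < r" for r
      using False that by (auto simp: indicator_def)
    then show ?thesis by simp
  qed
  then show ?thesis using False by simp
qed

lemma exhaustion_subset:
  "{a + 1 / (real n + 1)..b - 1 / (real n + 1)} \<subseteq> {a<..<b}"
proof -
  have "{a + r..b - r} \<subseteq> {a<..<b}" if "0 < r" for r :: real using that by auto
  then show ?thesis by simp
qed

lemma loc_integrable_set_integrable_Ioc:
  fixes h :: "real \<Rightarrow> real"
  assumes "loc_integrable {a<..<b} h" "{c..d} \<subseteq> {a<..<b}"
  shows "set_integrable lborel {c<..d} h"
proof -
  have "set_integrable lborel {c..d} h" using assms by (simp add: loc_integrable_def)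
  then show ?thesis by (rule set_integrable_subset) auto
qed

text \<open>Local integrability gives measurability on compact pieces only; on the open interval it
  comes from the exhaustion as a pointwise limit.\<close>

lemma loc_integrable_borel_measurable:
  fixes h :: "real \<Rightarrow> real"
  assumes "loc_integrable {a<..<b} h"
  shows "set_borel_measurable lborel {a<..<b} h"
  unfolding set_borel_measurable_def
proof (rule borel_measurable_LIMSEQ_real)
  fix n
  show "(\<lambda>x. indicator {a + 1 / (real n + 1)<..b - 1 / (real n + 1)} x *\<^sub>R h x) \<in> borel_measurable lborel"
    using loc_integrable_set_integrable_Ioc[OF assms exhaustion_subset]
    unfolding set_integrable_def by (rule borel_measurable_integrable)
  show "(\<lambda>n. indicator {a + 1 / (real n + 1)<..b - 1 / (real n + 1)} x *\<^sub>R h x)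
      \<longlonglongrightarrow> indicator {a<..<b} x *\<^sub>R h x" for x
    by (intro tendsto_scaleR interval_exhaustion tendsto_const)
qed

text \<open>Truncating h to a piece of the exhaustion makes it integrable on the line and leaves its
  interval integrals among the given ones. Countably many null sets are then united. Applied to a
  difference, this gives uniqueness of weak derivatives.\<close>

lemma AE_zero_on_interval:
  fixes h :: "real \<Rightarrow> real"
  assumes loc: "loc_integrable {a<..<b} h"
    and ivl: "\<And>c d. a < c \<Longrightarrow> c < d \<Longrightarrow> d < b \<Longrightarrow> (LINT x:{c<..d}|lborel. h x) = 0"
  shows "AE x in lborel. x \<in> {a<..<b} \<longrightarrow> h x = 0"
proof -
  define J where "J n = {a + 1 / (real n + 1)<..b - 1 / (real n + 1)}" for n
  have JJ: "(LINT x:{c<..d} \<inter> J n|lborel. h x) = 0" for c d n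
  proof -
    let ?c = "max c (a + 1 / (real n + 1))" and ?d = "min d (b - 1 / (real n + 1))"
    have eq: "{c<..d} \<inter> J n = {?c<..?d}" by (auto simp: J_def)
    have "a < max c (a + r) \<and> min d (b - r) < b" if "0 < r" for r using that by auto
    then have "a < ?c" "?d < b" by simp_all
    show ?thesis
    proof (cases "?c < ?d")
      case True
      show ?thesis unfolding eq by (rule ivl) (use \<open>a < ?c\<close> \<open>?d < b\<close> True in blast)+
    next
      case False
      then have "{?c<..?d} = {}" by (simp only: greaterThanAtMost_empty_iff not_less)
      then show ?thesis unfolding eq by (simp only:) (simp add: set_lebesgue_integral_def)
    qed
  qed
  have "AE x in lborel. indicator (J n) x * h x = 0" for n
  proof (rule AE_zero_if_interval_integrals_zero)
    show "integrable lborel (\<lambda>x. indicator (J n) x * h x)"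
      using loc_integrable_set_integrable_Ioc[OF loc exhaustion_subset]
      by (simp add: set_integrable_def J_def)
    \<comment> \<open>Any interval containing J n turns the total integral into an interval
      integral.\<close>
    have "(LINT x|lborel. indicator (J n) x * h x) = (LINT x:{a - 1<..b + 1} \<inter> J n|lborel. h x)"
    proof -
      have "{a + r<..b - r} \<subseteq> {a - 1<..b + 1}" if "0 < r" for r :: real using that by auto
      then have "J n \<subseteq> {a - 1<..b + 1}" by (simp add: J_def)
      then show ?thesis by (simp add: Int_absorb1 set_lebesgue_integral_def)
    qed
    then show "(LINT x|lborel. indicator (J n) x * h x) = 0" by (simp add: JJ)
    show "(LINT x:{c<..d}|lborel. indicator (J n) x * h x) = 0" for c d
      using JJ[of c d n] by (simp add: set_lebesgue_integral_def indicator_inter_arith mult.assoc)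
  qed
  then have "AE x in lborel. \<forall>n. indicator (J n) x * h x = 0" unfolding AE_all_countable by blast
  then show ?thesis
  proof eventually_elim
    case (elim x)
    have "(\<lambda>n. indicator (J n) x * h x) \<longlonglongrightarrow> indicator {a<..<b} x * h x"
      unfolding J_def by (intro tendsto_intros interval_exhaustion)
    then have "indicator {a<..<b} x * h x = 0" using elim by (simp add: LIMSEQ_const_iff)
    then show ?case by (auto simp: indicator_def split: if_splits)
  qed
qed

section \<open>Square integrable functions and the closure of the class of test functions\<close>

lemma L2_on_iff:
  fixes f :: "real \<Rightarrow> real"
  shows "L2_on U f \<longleftrightarrow> (\<lambda>x. indicator U x * f x) \<in> borel_measurable lborel \<and>
    integrable lborel (\<lambda>x. (indicator U x * f x)\<^sup>2)"
proof -
  have "(\<lambda>x. indicator U x *\<^sub>R (f x)\<^sup>2) = (\<lambda>x. (indicator U x * f x)\<^sup>2)"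
    by (auto simp: indicator_def fun_eq_iff)
  then show ?thesis by (simp add: L2_on_def set_borel_measurable_def set_integrable_def)
qed

text \<open>Young's inequality, from (s |x| - |y|)^2 \<ge> 0. With s free it stands in for
  Cauchy-Schwarz.\<close>

lemma abs_mult_le_weighted_squares:
  fixes x y s :: real
  assumes "0 < s"
  shows "\<bar>x * y\<bar> \<le> s / 2 * x\<^sup>2 + 1 / (2 * s) * y\<^sup>2"
proof -
  have "0 \<le> (s * \<bar>x\<bar> - \<bar>y\<bar>)\<^sup>2" by simp
  then have "2 * s * (\<bar>x\<bar> * \<bar>y\<bar>) \<le> s\<^sup>2 * x\<^sup>2 + y\<^sup>2" by (simp add: power2_diff power_mult_distrib)
  then show ?thesis using assms by (simp add: abs_mult field_simps power2_eq_square)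
qed

lemma square_integrable_mult:
  fixes f g :: "'a \<Rightarrow> real"
  assumes [measurable]: "f \<in> borel_measurable M" "g \<in> borel_measurable M"
    and "integrable M (\<lambda>x. (f x)\<^sup>2)" "integrable M (\<lambda>x. (g x)\<^sup>2)"
  shows "integrable M (\<lambda>x. f x * g x)"
proof (rule Bochner_Integration.integrable_bound)
  show "integrable M (\<lambda>x. 1 / 2 * (f x)\<^sup>2 + 1 / (2 * 1) * (g x)\<^sup>2)" using assms by simp
  show "AE x in M. norm (f x * g x) \<le> norm (1 / 2 * (f x)\<^sup>2 + 1 / (2 * 1) * (g x)\<^sup>2)"
    using abs_mult_le_weighted_squares[of 1] by (intro AE_I2) (force intro: order_trans)
qed simp

lemma integral_mult_le_weighted_squares:
  fixes f g :: "'a \<Rightarrow> real"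
  assumes "f \<in> borel_measurable M" "g \<in> borel_measurable M"
    and sq: "integrable M (\<lambda>x. (f x)\<^sup>2)" "integrable M (\<lambda>x. (g x)\<^sup>2)" and s: "0 < s"
  shows "\<bar>LINT x|M. f x * g x\<bar> \<le> s / 2 * (LINT x|M. (f x)\<^sup>2) + 1 / (2 * s) * (LINT x|M. (g x)\<^sup>2)"
proof -
  have "\<bar>LINT x|M. f x * g x\<bar> \<le> (LINT x|M. \<bar>f x * g x\<bar>)" by (rule integral_abs_bound)
  also have "\<dots> \<le> (LINT x|M. s / 2 * (f x)\<^sup>2 + 1 / (2 * s) * (g x)\<^sup>2)"
    by (intro integral_mono integrable_abs square_integrable_mult assms
        abs_mult_le_weighted_squares Bochner_Integration.integrable_add integrable_mult_right)
  finally show ?thesis using sq by simp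
qed

text \<open>In the splitting D k g = D k G n + D k (g - G n), dominated convergence makes g - G n
  small in L2 and the bound K makes the second integral small uniformly in k; n is fixed before k
  grows.\<close>

lemma weak_L2_limit_closed:
  fixes D :: "nat \<Rightarrow> 'a \<Rightarrow> real"
  assumes D: "\<And>k. D k \<in> borel_measurable M" "\<And>k. integrable M (\<lambda>x. (D k x)\<^sup>2)"
      "\<And>k. (LINT x|M. (D k x)\<^sup>2) \<le> K"
    and g: "g \<in> borel_measurable M" "integrable M (\<lambda>x. (g x)\<^sup>2)"
    and G: "\<And>n. G n \<in> borel_measurable M" "\<And>n x. \<bar>G n x\<bar> \<le> \<bar>g x\<bar>"
      "\<And>x. x \<in> space M \<Longrightarrow> (\<lambda>n. G n x) \<longlonglongrightarrow> g x"
    and lim: "\<And>n. (\<lambda>k. LINT x|M. D k x * G n x) \<longlonglongrightarrow> 0"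
  shows "(\<lambda>k. LINT x|M. D k x * g x) \<longlonglongrightarrow> 0"
proof (rule LIMSEQ_I)
  fix e :: real assume e: "0 < e"
  have "0 \<le> (LINT x|M. (D 0 x)\<^sup>2)" by simp
  then have K: "0 \<le> K" using D(3)[of 0] by linarith
  \<comment> \<open>The error budget is e/4 + e/2 + e/4: s K / 2 \<le> e/2 (adding 1 covers K = 0),
    and an L2 error below s e / 2 contributes less than e/4 after the factor 1 / (2 s).\<close>
  define s where "s = e / (K + 1)"
  have s: "0 < s" using e K by (simp add: s_def)
  note [measurable] = D(1) g(1) G(1)
  have GD: "\<bar>g x - G n x\<bar> \<le> 2 * \<bar>g x\<bar>" for n x using G(2)[of n x] by linarith
  have sqb: "(g x - G n x)\<^sup>2 \<le> 4 * (g x)\<^sup>2" for n x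
    using power_mono[OF GD[of x n] abs_ge_zero, of 2] by (simp add: power_mult_distrib)
  have int_sq: "integrable M (\<lambda>x. (G n x)\<^sup>2)" for n
    by (rule Bochner_Integration.integrable_bound[OF g(2)])
      (use G(2) in \<open>auto intro!: AE_I2 simp: abs_le_square_iff\<close>)
  have int_d: "integrable M (\<lambda>x. (g x - G n x)\<^sup>2)" for n
    by (rule Bochner_Integration.integrable_bound[of _ "\<lambda>x. 4 * (g x)\<^sup>2"])
      (use g(2) sqb in auto)
  have "(\<lambda>n. LINT x|M. (g x - G n x)\<^sup>2) \<longlonglongrightarrow> (LINT x|M. 0)"
  proof (rule integral_dominated_convergence[where w = "\<lambda>x. 4 * (g x)\<^sup>2"])
    have "(\<lambda>n. (g x - G n x)\<^sup>2) \<longlonglongrightarrow> (g x - g x)\<^sup>2" if "x \<in> space M" for x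
      by (intro tendsto_intros G(3) that)
    then show "AE x in M. (\<lambda>n. (g x - G n x)\<^sup>2) \<longlonglongrightarrow> 0" by (intro AE_I2) simp
  qed (use g(2) sqb in auto)
  then have "\<forall>\<^sub>F n in sequentially. (LINT x|M. (g x - G n x)\<^sup>2) < s * e / 2"
    using s e by (intro order_tendstoD(2)[where y = "LINT x|M. 0"]) auto
  then obtain n where n: "(LINT x|M. (g x - G n x)\<^sup>2) < s * e / 2"
    by (meson eventually_sequentially order_refl)
  obtain N where N: "\<And>k. N \<le> k \<Longrightarrow> \<bar>LINT x|M. D k x * G n x\<bar> < e / 4"
    using LIMSEQ_D[OF lim[of n], of "e / 4"] e by auto
  show "\<exists>N. \<forall>k\<ge>N. norm ((LINT x|M. D k x * g x) - 0) < e"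
  proof (intro exI allI impI)
    fix k assume k: "N \<le> k"
    have "(LINT x|M. D k x * g x) = (LINT x|M. D k x * G n x + D k x * (g x - G n x))"
      by (simp add: algebra_simps)
    also have "\<dots> = (LINT x|M. D k x * G n x) + (LINT x|M. D k x * (g x - G n x))"
      by (intro Bochner_Integration.integral_add square_integrable_mult D int_sq int_d) auto
    finally have "\<bar>LINT x|M. D k x * g x\<bar>
        \<le> \<bar>LINT x|M. D k x * G n x\<bar> + \<bar>LINT x|M. D k x * (g x - G n x)\<bar>" by simp
    moreover have "\<bar>LINT x|M. D k x * (g x - G n x)\<bar>
        \<le> s / 2 * (LINT x|M. (D k x)\<^sup>2) + 1 / (2 * s) * (LINT x|M. (g x - G n x)\<^sup>2)"
      by (intro integral_mult_le_weighted_squares D int_d s) simp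
    moreover have "s / 2 * (LINT x|M. (D k x)\<^sup>2) \<le> s / 2 * K"
      using s D(3) by (intro mult_left_mono) auto
    moreover have "s / 2 * K \<le> e / 2" using e K by (simp add: s_def field_simps)
    moreover have "1 / (2 * s) * (LINT x|M. (g x - G n x)\<^sup>2) < e / 4"
      using n s by (simp add: field_simps)
    ultimately show "norm ((LINT x|M. D k x * g x) - 0) < e" using N[OF k] by simp
  qed
qed

text \<open>Step functions determine weak \<open>L\<^sup>2\<close> convergence of a bounded sequence: the admissible test functions
  form a class closed under monotone limits, so the induction goes from intervals to Borel sets
  to nonnegative functions.\<close>

lemma weak_L2_convergence_from_intervals:
  fixes D :: "nat \<Rightarrow> real \<Rightarrow> real"
  assumes D: "\<And>k. D k \<in> borel_measurable lborel" "\<And>k. integrable lborel (\<lambda>x. (D k x)\<^sup>2)"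
      "\<And>k. (LINT x|lborel. (D k x)\<^sup>2) \<le> K"
    and ivl: "\<And>c d. a < c \<Longrightarrow> c < d \<Longrightarrow> d < b \<Longrightarrow>
      (\<lambda>k. LINT x|lborel. D k x * indicator {c<..d} x) \<longlonglongrightarrow> 0"
    and g: "g \<in> borel_measurable lborel" "integrable lborel (\<lambda>x. (g x)\<^sup>2)"
      "\<And>x. x \<notin> {a<..<b} \<Longrightarrow> g x = 0"
  shows "(\<lambda>k. LINT x|lborel. D k x * g x) \<longlonglongrightarrow> 0"
proof -
  let ?O = "{a<..<b}"
  note closed = weak_L2_limit_closed[OF D]
  have ind2: "integrable lborel (\<lambda>x. (indicator (A \<inter> ?O) x :: real)\<^sup>2)" if "A \<in> sets borel" for A
  proof -
    have "integrable lborel (indicator (A \<inter> ?O) :: real \<Rightarrow> real)"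
    proof (rule integrable_real_indicator)
      have "emeasure lborel (A \<inter> ?O) \<le> emeasure lborel ?O" by (rule emeasure_mono) auto
      also have "\<dots> < \<infinity>" by (cases "a \<le> b") auto
      finally show "emeasure lborel (A \<inter> ?O) < \<infinity>" .
    qed (use that in simp)
    moreover have "(\<lambda>x. (indicator (A \<inter> ?O) x :: real)\<^sup>2) = indicator (A \<inter> ?O)"
      by (auto simp: indicator_def fun_eq_iff)
    ultimately show ?thesis by simp
  qed
  \<comment> \<open>The hypothesis covers only intervals with both ends strictly inside (a, b). The
    others are cut to (a, b) and reached by the exhaustion.\<close>
  have Ioc: "(\<lambda>k. LINT x|lborel. D k x * indicator ({c<..d} \<inter> ?O) x) \<longlonglongrightarrow> 0" for c d
  proof (rule closed[where G = "\<lambda>n. indicator ({c<..d} \<inter> {a + 1 / (real n + 1)<..b - 1 / (real n + 1)})"])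
    show "integrable lborel (\<lambda>x. (indicator ({c<..d} \<inter> ?O) x :: real)\<^sup>2)" by (rule ind2) simp
    fix n x
    have "{a + 1 / (real n + 1)<..b - 1 / (real n + 1)} \<subseteq> ?O"
      using exhaustion_subset[of a n b] by (auto simp: subset_iff)
    then show "\<bar>indicator ({c<..d} \<inter> {a + 1 / (real n + 1)<..b - 1 / (real n + 1)}) x :: real\<bar>
        \<le> \<bar>indicator ({c<..d} \<inter> ?O) x\<bar>" by (auto simp: indicator_def)
    show "(\<lambda>n. indicator ({c<..d} \<inter> {a + 1 / (real n + 1)<..b - 1 / (real n + 1)}) x :: real)
        \<longlonglongrightarrow> indicator ({c<..d} \<inter> ?O) x"
      unfolding indicator_inter_arith by (intro tendsto_intros interval_exhaustion)
    let ?c = "max c (a + 1 / (real n + 1))" and ?d = "min d (b - 1 / (real n + 1))"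
    have eq: "{c<..d} \<inter> {a + 1 / (real n + 1)<..b - 1 / (real n + 1)} = {?c<..?d}" by auto
    have "a < max c (a + r) \<and> min d (b - r) < b" if "0 < r" for r using that by auto
    then have "a < ?c" "?d < b" by simp_all
    show "(\<lambda>k. LINT x|lborel. D k x *
        indicator ({c<..d} \<inter> {a + 1 / (real n + 1)<..b - 1 / (real n + 1)}) x) \<longlonglongrightarrow> 0"
    proof (cases "?c < ?d")
      case True
      show ?thesis unfolding eq by (rule ivl) (use \<open>a < ?c\<close> \<open>?d < b\<close> True in blast)+
    next
      case False
      then have "{?c<..?d} = {}" by (simp only: greaterThanAtMost_empty_iff not_less)
      then show ?thesis unfolding eq by (simp only:) simp
    qed
  qed auto
  have DO: "integrable lborel (\<lambda>x. D k x * indicator (A \<inter> ?O) x)" if "A \<in> sets borel" for A k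
    using that by (intro square_integrable_mult D ind2) auto
  have sets: "(\<lambda>k. LINT x|lborel. D k x * indicator (A \<inter> ?O) x) \<longlonglongrightarrow> 0"
    if A: "A \<in> sets borel" for A
  proof -
    have borel: "A \<in> sets borel" if "A \<in> sigma_sets UNIV (range (\<lambda>(a, b). {a<..b::real}))" for A
      using that by (simp add: borel_sigma_sets_Ioc)
    have G: "range (\<lambda>(a, b). {a<..b::real}) \<subseteq> Pow UNIV" by simp
    have "A \<in> sigma_sets UNIV (range (\<lambda>(a, b). {a<..b::real}))"
      using A by (simp add: borel_sigma_sets_Ioc)
    with Int_stable_Ioc G show ?thesis
    proof (induction rule: sigma_sets_induct_disjoint)
      case (basic A)
      then show ?case using Ioc by auto
    next
      case (compl A)
      \<comment> \<open>Complements need the indicator of the whole of (a, b), obtained from a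
        larger interval.\<close>
      have "{a - 1<..b + 1} \<inter> ?O = ?O" by auto
      then have "(\<lambda>k. LINT x|lborel. D k x * indicator ?O x) \<longlonglongrightarrow> 0" using Ioc[of "a - 1" "b + 1"] by simp
      from tendsto_diff[OF this compl(2)]
      have "(\<lambda>k. (LINT x|lborel. D k x * indicator ?O x) - (LINT x|lborel. D k x * indicator (A \<inter> ?O) x)) \<longlonglongrightarrow> 0"
        by simp
      moreover have "(LINT x|lborel. D k x * indicator ?O x) - (LINT x|lborel. D k x * indicator (A \<inter> ?O) x)
          = (LINT x|lborel. D k x * indicator ((UNIV - A) \<inter> ?O) x)" for k
      proof -
        have "integrable lborel (\<lambda>x. D k x * indicator ?O x)" using DO[of UNIV k] by simp
        then have "(LINT x|lborel. D k x * indicator ?O x) - (LINT x|lborel. D k x * indicator (A \<inter> ?O) x)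
          = (LINT x|lborel. D k x * indicator ?O x - D k x * indicator (A \<inter> ?O) x)"
          using DO[OF borel[OF compl(1)], of k] by (rule Bochner_Integration.integral_diff[symmetric])
        also have "\<dots> = (LINT x|lborel. D k x * indicator ((UNIV - A) \<inter> ?O) x)"
          by (intro Bochner_Integration.integral_cong) (auto simp: indicator_def)
        finally show ?thesis .
      qed
      ultimately show ?case by simp
    next
      case (union A)
      have m: "A i \<in> sets borel" for i using union borel by blast
      show ?case
      \<comment> \<open>Limits in k cannot be exchanged with an infinite sum directly; finite
        partial unions are handled by linearity and the closure lemma passes to the countable
        union.\<close>
      proof (rule closed[where G = "\<lambda>n. indicator ((\<Union>i<n. A i) \<inter> ?O)"])
        show "integrable lborel (\<lambda>x. (indicator ((\<Union>i. A i) \<inter> ?O) x :: real)\<^sup>2)"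
          using m by (intro ind2) auto
        fix n x
        show "\<bar>indicator ((\<Union>i<n. A i) \<inter> ?O) x :: real\<bar> \<le> \<bar>indicator ((\<Union>i. A i) \<inter> ?O) x\<bar>"
          by (auto simp: indicator_def)
        show "(\<lambda>n. indicator ((\<Union>i<n. A i) \<inter> ?O) x :: real) \<longlonglongrightarrow> indicator ((\<Union>i. A i) \<inter> ?O) x"
          unfolding indicator_inter_arith by (intro tendsto_intros LIMSEQ_indicator_UN)
        have "indicator ((\<Union>i<n. A i) \<inter> ?O) y = (\<Sum>i<n. indicator (A i \<inter> ?O) y :: real)" for y
          unfolding indicator_inter_arith sum_distrib_right[symmetric]
          using union(1) by (subst indicator_UN_disjoint) (auto simp: disjoint_family_on_def)
        then have "(LINT x|lborel. D k x * indicator ((\<Union>i<n. A i) \<inter> ?O) x)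
            = (LINT x|lborel. (\<Sum>i<n. D k x * indicator (A i \<inter> ?O) x))" for k
          by (simp only: sum_distrib_left)
        also have "\<dots> k = (\<Sum>i<n. LINT x|lborel. D k x * indicator (A i \<inter> ?O) x)" for k
          by (rule Bochner_Integration.integral_sum) (rule DO[OF m])
        finally show "(\<lambda>k. LINT x|lborel. D k x * indicator ((\<Union>i<n. A i) \<inter> ?O) x) \<longlonglongrightarrow> 0"
          using tendsto_sum[of "{..<n}", OF union(3)] by simp
      qed (use m in auto)
    qed auto
  qed
  \<comment> \<open>Square integrability is a premise inside the induction formula, because the
    induction runs through all nonnegative measurable functions; each case must pass the premise
    down to its constituents.\<close>
  have pos: "integrable lborel (\<lambda>x. (indicator ?O x * u x)\<^sup>2) \<longrightarrow>
      (\<lambda>k. LINT x|lborel. D k x * (indicator ?O x * u x)) \<longlonglongrightarrow> 0"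
    if u: "u \<in> borel_measurable lborel" "\<And>x. 0 \<le> u x" for u :: "real \<Rightarrow> real"
    using u
  proof (induction rule: borel_measurable_induct_real)
    case (set A)
    then show ?case using sets[of A] by (simp add: indicator_inter_arith mult.commute)
  next
    case (mult u c)
    show ?case
    \<comment> \<open>For c = 0 the square integrability of c u says nothing about u, but then all
      integrals are 0.\<close>
    proof (cases "c = 0")
      case False
      have "integrable lborel (\<lambda>x. (indicator ?O x * u x)\<^sup>2)"
        if "integrable lborel (\<lambda>x. (indicator ?O x * (c * u x))\<^sup>2)"
      proof -
        have "(\<lambda>x. (indicator ?O x * (c * u x))\<^sup>2) = (\<lambda>x. c\<^sup>2 * (indicator ?O x * u x)\<^sup>2)"
          by (simp add: power_mult_distrib mult.left_commute)
        then show ?thesis using that False by simp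
      qed
      moreover have "(\<lambda>k. LINT x|lborel. D k x * (indicator ?O x * (c * u x)))
          = (\<lambda>k. c * (LINT x|lborel. D k x * (indicator ?O x * u x)))"
        by (simp add: mult.left_commute)
      ultimately show ?thesis using mult.IH tendsto_mult_right_zero by fastforce
    qed simp
  next
    case (add u v)
    note [measurable] = add.hyps(1,3)
    show ?case
    proof
      assume L: "integrable lborel (\<lambda>x. (indicator ?O x * (v x + u x))\<^sup>2)"
      \<comment> \<open>Nonnegativity rules out cancellation, so each summand is dominated by the
        sum and inherits its square integrability.\<close>
      have le: "w x \<le> v x + u x \<Longrightarrow> 0 \<le> w x \<Longrightarrow> (indicator ?O x * w x)\<^sup>2 \<le> (indicator ?O x * (v x + u x))\<^sup>2" for x and w
        by (intro power_mono mult_left_mono) auto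
      have i: "integrable lborel (\<lambda>x. (indicator ?O x * w x)\<^sup>2)"
        if "\<And>x. 0 \<le> w x" "\<And>x. w x \<le> v x + u x" "w \<in> borel_measurable lborel" for w
      proof (rule Bochner_Integration.integrable_bound[OF L])
        show "(\<lambda>x. (indicator ?O x * w x)\<^sup>2) \<in> borel_measurable lborel" using that(3) by simp
      qed (use that le[of w] in auto)
      have iu: "integrable lborel (\<lambda>x. (indicator ?O x * u x)\<^sup>2)"
        and iv: "integrable lborel (\<lambda>x. (indicator ?O x * v x)\<^sup>2)"
        using add.hyps by (auto intro!: i)
      have "(LINT x|lborel. D k x * (indicator ?O x * (v x + u x)))
         = (LINT x|lborel. D k x * (indicator ?O x * v x)) + (LINT x|lborel. D k x * (indicator ?O x * u x))" for k
        unfolding distrib_left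
        by (intro Bochner_Integration.integral_add square_integrable_mult D iu iv) simp_all
      moreover have "(\<lambda>k. (LINT x|lborel. D k x * (indicator ?O x * v x))
          + (LINT x|lborel. D k x * (indicator ?O x * u x))) \<longlonglongrightarrow> 0 + 0"
        using add.IH iu iv by (intro tendsto_add) auto
      ultimately show "(\<lambda>k. LINT x|lborel. D k x * (indicator ?O x * (v x + u x))) \<longlonglongrightarrow> 0" by simp
    qed
  next
    case (seq U)
    note [measurable] = seq.hyps(1) u(1)
    have le: "U n x \<le> u x" for n x
      using seq.hyps by (intro incseq_le[of "\<lambda>n. U n x"]) (auto simp: incseq_def le_fun_def)
    show ?case
    proof
      assume L: "integrable lborel (\<lambda>x. (indicator ?O x * u x)\<^sup>2)"
      have "(indicator ?O x * U n x)\<^sup>2 \<le> (indicator ?O x * u x)\<^sup>2" for n x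
        by (intro power_mono mult_left_mono le) (auto simp: seq.hyps(2))
      then have i: "integrable lborel (\<lambda>x. (indicator ?O x * U n x)\<^sup>2)" for n
        by (intro Bochner_Integration.integrable_bound[OF L]) auto
      show "(\<lambda>k. LINT x|lborel. D k x * (indicator ?O x * u x)) \<longlonglongrightarrow> 0"
      proof (rule closed[where G = "\<lambda>n x. indicator ?O x * U n x", OF _ L])
        show "\<bar>indicator ?O x * U n x\<bar> \<le> \<bar>indicator ?O x * u x\<bar>" for n x
          using le[of n x] seq.hyps(2)[of n x] u(2)[of x] by (auto simp: indicator_def)
        show "(\<lambda>n. indicator ?O x * U n x) \<longlonglongrightarrow> indicator ?O x * u x" for x
          using seq.hyps by (intro tendsto_intros) auto
      qed (use seq.IH i in auto)
    qed
  qed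
  note [measurable] = g(1)
  define p q where "p x = max (g x) 0" and "q x = max (- g x) 0" for x
  have mp: "p \<in> borel_measurable lborel" "q \<in> borel_measurable lborel"
    unfolding p_def[abs_def] q_def[abs_def] by measurable
  have ip: "integrable lborel (\<lambda>x. (indicator ?O x * p x)\<^sup>2)" "integrable lborel (\<lambda>x. (indicator ?O x * q x)\<^sup>2)"
    by (rule Bochner_Integration.integrable_bound[OF g(2)];
        use mp in \<open>force simp: p_def q_def indicator_def max_def\<close>)+
  have gx: "g x = indicator ?O x * p x - indicator ?O x * q x" for x
    using g(3)[of x] by (cases "x \<in> ?O") (simp_all add: p_def q_def max_def)
  have "(LINT x|lborel. D k x * g x) = (LINT x|lborel. D k x * (indicator ?O x * p x))
      - (LINT x|lborel. D k x * (indicator ?O x * q x))" for k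
    unfolding gx right_diff_distrib using ip mp
    by (intro Bochner_Integration.integral_diff square_integrable_mult D) auto
  moreover have "(\<lambda>k. (LINT x|lborel. D k x * (indicator ?O x * p x))
      - (LINT x|lborel. D k x * (indicator ?O x * q x))) \<longlonglongrightarrow> 0 - 0"
    by (intro tendsto_diff pos[rule_format] mp ip) (auto simp: p_def q_def)
  ultimately show ?thesis by simp
qed


section \<open>Compactness and weak convergence in \<open>H\<^sup>1\<close>\<close>

lemma H1_has_weak_deriv: "H1 U f \<Longrightarrow> has_weak_deriv 1 1 U f (weak_deriv 1 1 U f)"
  unfolding H1_def weakly_diff_def weak_deriv_def
  using someI_ex[of "has_weak_deriv 1 1 U f"] by blast

text \<open>\<open>H1\<close> speaks of the representative chosen by \<open>weak_deriv\<close>, not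
  of g. By \<open>weak_deriv_FTC\<close> both have the increments of v as integrals over intervals,
  so they agree a.e. and the L2 bound carries over.\<close>

lemma H1I:
  assumes v: "continuous_on {a<..<b} v" "L2_on {a<..<b} v"
    and g: "has_weak_deriv 1 1 {a<..<b} v g" "L2_on {a<..<b} g"
  shows "H1 {a<..<b} v"
proof -
  let ?O = "{a<..<b}" and ?g = "weak_deriv 1 1 {a<..<b} v"
  have w: "has_weak_deriv 1 1 ?O v ?g"
    unfolding weak_deriv_def using g(1) by (rule someI[of "has_weak_deriv 1 1 ?O v"])
  have loc: "loc_integrable ?O ?g" "loc_integrable ?O g"
    using w g(1) by (auto simp: has_weak_deriv_def)
  have "AE x in lborel. x \<in> ?O \<longrightarrow> ?g x - g x = 0"
  proof (rule AE_zero_on_interval)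
    show "loc_integrable ?O (\<lambda>x. ?g x - g x)"
      using loc by (auto simp: loc_integrable_def intro: set_integral_diff(1))
    fix c d assume cd: "a < c" "c < d" "d < b"
    then have "{c..d} \<subseteq> ?O" by auto
    then show "(LINT x:{c<..d}|lborel. ?g x - g x) = 0"
      using weak_deriv_FTC[OF v(1) w cd] weak_deriv_FTC[OF v(1) g(1) cd]
        loc[THEN loc_integrable_set_integrable_Ioc] by simp
  qed
  then have ae: "AE x in lborel. (indicator ?O x * ?g x)\<^sup>2 = (indicator ?O x * g x)\<^sup>2"
    by eventually_elim (auto simp: indicator_def)
  have m: "(\<lambda>x. indicator ?O x * ?g x) \<in> borel_measurable lborel"
    using loc_integrable_borel_measurable[OF loc(1)] by (simp add: set_borel_measurable_def)
  have "integrable lborel (\<lambda>x. (indicator ?O x * ?g x)\<^sup>2)"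
  proof (rule integrable_cong_AE_imp)
    show "integrable lborel (\<lambda>x. (indicator ?O x * g x)\<^sup>2)" using g(2) by (simp add: L2_on_iff)
    show "(\<lambda>x. (indicator ?O x * ?g x)\<^sup>2) \<in> borel_measurable lborel"
      using m by (rule borel_measurable_power)
    show "AE x in lborel. (indicator ?O x * g x)\<^sup>2 = (indicator ?O x * ?g x)\<^sup>2"
      using ae by eventually_elim simp
  qed
  then show ?thesis using v(2) g(1) m by (auto simp: H1_def weakly_diff_def L2_on_iff)
qed

section \<open>Equicontinuity and uniform compactness\<close>

lemma set_integral_square:
  fixes g :: "real \<Rightarrow> real"
  shows "(LINT x:U|lborel. (g x)\<^sup>2) = (LINT x|lborel. (indicator U x * g x)\<^sup>2)"
  unfolding set_lebesgue_integral_def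
  by (intro Bochner_Integration.integral_cong) (auto simp: indicator_def)

text \<open>The increment of f is the integral of f' times the indicator of {x<..y}. Young's
  inequality with s = sqrt (y - x) bounds it by s K / 2 + (y - x) / (2 s), which is (K + 1) / 2
  times s.\<close>

lemma H1_modulus_of_continuity:
  assumes f: "H1 {a<..<b} f" "continuous_on {a<..<b} f"
    and K: "(LINT x:{a<..<b}|lborel. (weak_deriv 1 1 {a<..<b} f x)\<^sup>2) \<le> K"
    and xy: "x \<in> {a<..<b}" "y \<in> {a<..<b}"
  shows "\<bar>f x - f y\<bar> \<le> (K + 1) / 2 * sqrt \<bar>x - y\<bar>"
  using xy
proof (induction x y rule: linorder_wlog)
  case (le x y)
  show ?case
  proof (cases "x = y")
    case False
    let ?g = "\<lambda>t. indicator {a<..<b} t * weak_deriv 1 1 {a<..<b} f t"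
      and ?i = "\<lambda>t. indicator {x<..y} t :: real"
    define s where "s = sqrt (y - x)"
    have s: "0 < s" "s * s = y - x" using le False by (auto simp: s_def)
    have xy: "a < x" "x < y" "y < b" using le False by auto
    have "f y - f x = (LINT t:{x<..y}|lborel. weak_deriv 1 1 {a<..<b} f t)"
      by (rule weak_deriv_FTC[OF f(2) H1_has_weak_deriv[OF f(1)] xy, symmetric])
    also have "\<dots> = (LINT t|lborel. ?g t * ?i t)"
      unfolding set_lebesgue_integral_def
      by (intro Bochner_Integration.integral_cong) (use xy in \<open>auto simp: indicator_def\<close>)
    finally have eq: "f y - f x = (LINT t|lborel. ?g t * ?i t)" .
    have i2: "(\<lambda>t. (?i t)\<^sup>2) = ?i" by (auto simp: indicator_def fun_eq_iff)
    have "\<bar>f y - f x\<bar> \<le> s / 2 * (LINT t|lborel. (?g t)\<^sup>2) + 1 / (2 * s) * (LINT t|lborel. (?i t)\<^sup>2)"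
      unfolding eq
    proof (rule integral_mult_le_weighted_squares)
      show "integrable lborel (\<lambda>t. (?i t)\<^sup>2)" unfolding i2 using xy by (simp add: integrable_real_indicator)
    qed (use f(1) s in \<open>auto simp: H1_def L2_on_iff\<close>)
    also have "(LINT t|lborel. (?i t)\<^sup>2) = s * s" unfolding i2 using xy s(2) by simp
    also have "s / 2 * (LINT t|lborel. (?g t)\<^sup>2) \<le> s / 2 * K"
      using K s(1) by (simp add: set_integral_square)
    finally have "\<bar>f y - f x\<bar> \<le> s / 2 * K + 1 / (2 * s) * (s * s)" by simp
    also have "\<dots> = (K + 1) / 2 * s" using s(1) by (simp add: field_simps)
    finally show ?thesis using xy by (simp add: s_def abs_minus_commute)
  qed simp
next
  case (sym x y)
  then show ?case by (simp add: abs_minus_commute)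
qed

text \<open>The weak derivative controls f in the open interval only, while Arzela-Ascoli works on
  the compact one; the inequality is closed under limits in (x, y).\<close>

lemma modulus_of_continuity_closure:
  fixes f :: "real \<Rightarrow> real"
  assumes ab: "a < b" and f: "continuous_on {a..b} f"
    and m: "\<And>x y. x \<in> {a<..<b} \<Longrightarrow> y \<in> {a<..<b} \<Longrightarrow> \<bar>f x - f y\<bar> \<le> C * sqrt \<bar>x - y\<bar>"
    and xy: "x \<in> {a..b}" "y \<in> {a..b}"
  shows "\<bar>f x - f y\<bar> \<le> C * sqrt \<bar>x - y\<bar>"
proof -
  let ?S = "{a<..<b} \<times> {a<..<b}" and ?F = "\<lambda>z. \<bar>f (fst z) - f (snd z)\<bar> - C * sqrt \<bar>fst z - snd z\<bar>"
  have cl: "closure ?S = {a..b} \<times> {a..b}" using ab by (simp add: closure_Times)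
  have "?F (x, y) \<le> 0"
  proof (rule continuous_le_on_closure[where S = ?S and f = ?F and x = "(x, y)"])
    show "continuous_on (closure ?S) ?F"
      unfolding cl
      by (intro continuous_intros continuous_on_compose2[OF f]) auto
    show "(x, y) \<in> closure ?S" unfolding cl using xy by simp
    show "?F z \<le> 0" if "z \<in> ?S" for z using m[of "fst z" "snd z"] that by auto
  qed
  then show ?thesis by simp
qed

text \<open>The sup bound comes from the mass: f k stays above f k x - C sqrt (b - a) on the whole
  interval, and integrating this lower bound gives at most m.\<close>

lemma H1_bounded_compactness:
  fixes f :: "nat \<Rightarrow> real \<Rightarrow> real"
  assumes ab: "a < b" and H1: "\<And>k. H1 {a<..<b} (f k)" and cont: "\<And>k. continuous_on {a..b} (f k)"
    and nonneg: "\<And>k x. x \<in> {a..b} \<Longrightarrow> 0 \<le> f k x"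
    and mass: "\<And>k. (LINT x:{a<..<b}|lborel. f k x) = m"
    and K: "\<And>k. (LINT x:{a<..<b}|lborel. (weak_deriv 1 1 {a<..<b} (f k) x)\<^sup>2) \<le> K"
  obtains v s where "strict_mono (s :: nat \<Rightarrow> nat)" "uniform_limit {a<..<b} (\<lambda>j. f (s j)) v sequentially"
proof -
  define C where "C = (K + 1) / 2"
  have "0 \<le> (LINT x:{a<..<b}|lborel. (weak_deriv 1 1 {a<..<b} (f 0) x)\<^sup>2)"
    by (simp add: set_integral_square)
  then have C: "0 < C" using K[of 0] by (simp add: C_def)
  have mod: "\<bar>f k x - f k y\<bar> \<le> C * sqrt \<bar>x - y\<bar>" if "x \<in> {a..b}" "y \<in> {a..b}" for k x y
    unfolding C_def using ab cont[of k] _ that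
  proof (rule modulus_of_continuity_closure)
    have "continuous_on {a<..<b} (f k)" using cont by (rule continuous_on_subset) auto
    then show "\<bar>f k x - f k y\<bar> \<le> (K + 1) / 2 * sqrt \<bar>x - y\<bar>"
      if "x \<in> {a<..<b}" "y \<in> {a<..<b}" for x y
      by (rule H1_modulus_of_continuity[OF H1 _ K that])
  qed
  have bound: "f k x \<le> m / (b - a) + C * sqrt (b - a)" if x: "x \<in> {a..b}" for k x
  proof -
    let ?c = "f k x - C * sqrt (b - a)"
    have "?c \<le> f k y" if y: "y \<in> {a<..<b}" for y
    proof -
      have "\<bar>f k x - f k y\<bar> \<le> C * sqrt \<bar>x - y\<bar>" using x y by (intro mod) auto
      also have "\<dots> \<le> C * sqrt (b - a)"
        using x y C by (intro mult_left_mono real_sqrt_le_mono) auto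
      finally show ?thesis by linarith
    qed
    moreover have "set_integrable lborel {a<..<b} (f k)"
      by (rule set_integrable_subset[OF borel_integrable_atLeastAtMost'[OF cont[of k]]]) auto
    moreover have "set_integrable lborel {a<..<b} (\<lambda>_. ?c)"
      using ab by (simp add: set_integrable_def)
    ultimately have "(LINT y:{a<..<b}|lborel. ?c) \<le> (LINT y:{a<..<b}|lborel. f k y)"
      by (intro set_integral_mono)
    then have "(b - a) * ?c \<le> m" using ab mass by (simp add: set_integral_const)
    then show ?thesis using ab by (simp add: field_simps)
  qed
  obtain g s where g: "strict_mono (s :: nat \<Rightarrow> nat)"
    "\<And>e. 0 < e \<Longrightarrow> \<exists>N. \<forall>n x. N \<le> n \<and> x \<in> {a..b} \<longrightarrow> norm (f (s n) x - g x) < e"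
  proof (rule Arzela_Ascoli[of "{a..b}" f "m / (b - a) + C * sqrt (b - a)"])
    show "norm (f n x) \<le> m / (b - a) + C * sqrt (b - a)" if "x \<in> {a..b}" for n x
      using bound[OF that] nonneg[OF that] by simp
    fix x e :: real assume x: "x \<in> {a..b}" and e: "0 < e"
    show "\<exists>d>0. \<forall>n y. y \<in> {a..b} \<and> norm (x - y) < d \<longrightarrow> norm (f n x - f n y) < e"
    proof (intro exI conjI allI impI)
      \<comment> \<open>The inverse of the modulus C sqrt r at e; it depends neither on n nor on
        x.\<close>
      show "0 < (e / C)\<^sup>2" using e C by simp
      fix n y assume y: "y \<in> {a..b} \<and> norm (x - y) < (e / C)\<^sup>2"
      then have "sqrt \<bar>x - y\<bar> < sqrt ((e / C)\<^sup>2)" by (intro real_sqrt_less_mono) simp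
      then have "sqrt \<bar>x - y\<bar> < e / C" using e C by (simp only: real_sqrt_abs) simp
      then have "C * sqrt \<bar>x - y\<bar> < e" using C by (simp add: pos_less_divide_eq mult.commute)
      then show "norm (f n x - f n y) < e" using mod[OF x, of y n] y by simp
    qed
  qed (auto intro: that)
  have "uniform_limit {a<..<b} (\<lambda>j. f (s j)) g sequentially"
  proof (rule uniform_limitI)
    fix e :: real assume "0 < e"
    then obtain N where "\<forall>n x. N \<le> n \<and> x \<in> {a..b} \<longrightarrow> norm (f (s n) x - g x) < e" using g(2) by blast
    then show "\<forall>\<^sub>F n in sequentially. \<forall>x\<in>{a<..<b}. dist (f (s n) x) (g x) < e"
      by (intro eventually_sequentiallyI[of N]) (auto simp: dist_norm)
  qed
  with g(1) show thesis by (rule that)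
qed

text \<open>If convergence failed, infinitely many indices would stay at distance e from v. Their
  enumeration is a subsequence, which by compactness accumulates at some w; as w = v on S, this
  contradicts the distance. Uniqueness is asked on S only, since uniform convergence on S does not
  see other values.\<close>

lemma uniform_limit_if_unique_accumulation:
  fixes f :: "nat \<Rightarrow> real \<Rightarrow> real"
  assumes compact: "\<And>s. strict_mono s \<Longrightarrow>
      \<exists>r w. strict_mono (r :: nat \<Rightarrow> nat) \<and> uniform_limit S (\<lambda>j. f (s (r j))) w sequentially"
    and unique: "\<And>w. accum_point S f w \<Longrightarrow> \<forall>x\<in>S. w x = v x"
  shows "uniform_limit S f v sequentially"
proof (rule ccontr)
  assume "\<not> uniform_limit S f v sequentially"
  then obtain e where e: "0 < e" "\<not> (\<forall>\<^sub>F k in sequentially. \<forall>x\<in>S. dist (f k x) (v x) < e)"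
    unfolding uniform_limit_iff by blast
  define A where "A = {k. \<not> (\<forall>x\<in>S. dist (f k x) (v x) < e)}"
  have "infinite A" using e(2) by (simp add: A_def eventually_cofinite flip: cofinite_eq_sequentially)
  then have s: "strict_mono (enumerate A)" "\<And>k. enumerate A k \<in> A"
    by (auto simp: strict_mono_enumerate enumerate_in_set)
  obtain r w where r: "strict_mono (r :: nat \<Rightarrow> nat)" "uniform_limit S (\<lambda>j. f (enumerate A (r j))) w sequentially"
    using compact[OF s(1)] by blast
  have "accum_point S f w"
    unfolding accum_point_def using strict_mono_o[OF s(1) r(1)] r(2)
    by (intro exI[of _ "enumerate A \<circ> r"]) simp
  then have "uniform_limit S (\<lambda>j. f (enumerate A (r j))) v sequentially"
    using unique r(2) by (subst uniform_limit_cong'[where g = "\<lambda>j. f (enumerate A (r j))" and i = w]) auto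
  from uniform_limitD[OF this e(1)]
  obtain j where "\<forall>x\<in>S. dist (f (enumerate A (r j)) x) (v x) < e"
    using eventually_happens'[OF sequentially_bot] by blast
  then show False using s(2)[of "r j"] by (simp add: A_def)
qed

text \<open>The inner product has two parts. In the first, uniform convergence is paired with an
  integrable g. In the second, f k' - v' is bounded in L2 and, by \<open>weak_deriv_FTC\<close>, its
  interval integrals are differences of point values, which converge.\<close>

lemma weak_conv_H1_if_uniform_limit:
  fixes f :: "nat \<Rightarrow> real \<Rightarrow> real"
  assumes H1: "\<And>k. H1 {a<..<b} (f k)" "H1 {a<..<b} v"
    and cont: "\<And>k. continuous_on {a<..<b} (f k)"
    and K: "\<And>k. (LINT x:{a<..<b}|lborel. (weak_deriv 1 1 {a<..<b} (f k) x)\<^sup>2) \<le> K"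
    and lim: "uniform_limit {a<..<b} f v sequentially"
  shows "weak_conv_H1 {a<..<b} f v"
proof -
  let ?O = "{a<..<b}"
  let ?d = "\<lambda>f x. indicator ?O x * weak_deriv 1 1 ?O f x"
  have cv: "continuous_on ?O v"
    by (rule uniform_limit_theorem[OF _ lim]) (simp_all add: cont)
  have d: "?d h \<in> borel_measurable lborel" "integrable lborel (\<lambda>x. (?d h x)\<^sup>2)" if "H1 ?O h" for h
    using that by (auto simp: H1_def L2_on_iff)
  have z: "(\<lambda>x. indicator ?O x * h x) \<in> borel_measurable lborel"
    "integrable lborel (\<lambda>x. (indicator ?O x * h x)\<^sup>2)" if "H1 ?O h" for h
    using that by (auto simp: H1_def L2_on_iff)
  have i2: "integrable lborel (\<lambda>x. (indicator {c<..d} x :: real)\<^sup>2)" for c d :: real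
  proof -
    have "(\<lambda>x. (indicator {c<..d} x :: real)\<^sup>2) = indicator {c<..d}" by (auto simp: indicator_def fun_eq_iff)
    then show ?thesis by (cases "c \<le> d") (simp_all add: integrable_real_indicator)
  qed
  have pw: "(\<lambda>k. f k x) \<longlonglongrightarrow> v x" if "x \<in> ?O" for x
    using tendsto_uniform_limitI[OF lim that] .
  have "(\<lambda>k. H1_inner ?O (f k) g) \<longlonglongrightarrow> H1_inner ?O v g" if g: "H1 ?O g" for g
  proof -
    have prod: "(LINT x:?O|lborel. p x * q x) = (LINT x|lborel. (indicator ?O x * p x) * (indicator ?O x * q x))"
      for p q :: "real \<Rightarrow> real"
      unfolding set_lebesgue_integral_def
      by (intro Bochner_Integration.integral_cong) (auto simp: indicator_def)
    \<comment> \<open>On a bounded interval square integrability gives integrability: the extra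
      factor is the indicator of a set of finite length.\<close>
    have "integrable lborel (\<lambda>x. (indicator ?O x * g x) * indicator {a<..b} x)"
      by (rule square_integrable_mult[OF z(1)[OF g] _ z(2)[OF g] i2]) simp
    moreover have "(indicator ?O x * g x) * indicator {a<..b} x = indicator ?O x * g x" for x
      by (auto simp: indicator_def)
    ultimately have gi: "integrable lborel (\<lambda>x. indicator ?O x * g x)" by simp
    have fg: "set_integrable lborel ?O (\<lambda>x. h x * g x)" if "H1 ?O h" for h
    proof -
      have "(\<lambda>x. indicator ?O x *\<^sub>R (h x * g x)) = (\<lambda>x. (indicator ?O x * h x) * (indicator ?O x * g x))"
        by (auto simp: indicator_def fun_eq_iff)
      then show ?thesis using square_integrable_mult[OF z(1)[OF that] z(1)[OF g] z(2)[OF that] z(2)[OF g]]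
        by (simp add: set_integrable_def)
    qed
    have "(\<lambda>k. LINT x:?O|lborel. f k x * g x) \<longlonglongrightarrow> (LINT x:?O|lborel. v x * g x)"
    proof (rule LIMSEQ_I)
      fix e :: real assume e: "0 < e"
      define L where "L = (LINT x|lborel. \<bar>indicator ?O x * g x\<bar>)"
      have L: "0 \<le> L" by (simp add: L_def)
      define e' where "e' = e / (L + 1)"
      have e': "0 < e'" using e L by (simp add: e'_def)
      obtain N where N: "\<And>k x. N \<le> k \<Longrightarrow> x \<in> ?O \<Longrightarrow> \<bar>f k x - v x\<bar> < e'"
        using uniform_limitD[OF lim e'] unfolding eventually_sequentially dist_real_def by blast
      show "\<exists>N. \<forall>k\<ge>N. norm ((LINT x:?O|lborel. f k x * g x) - (LINT x:?O|lborel. v x * g x)) < e"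
      proof (intro exI allI impI)
        fix k assume k: "N \<le> k"
        have i: "integrable lborel (\<lambda>x. indicator ?O x * ((f k x - v x) * g x))"
          using set_integral_diff(1)[OF fg[OF H1(1)[of k]] fg[OF H1(2)]]
          by (simp add: set_integrable_def algebra_simps)
        have "(LINT x:?O|lborel. f k x * g x) - (LINT x:?O|lborel. v x * g x)
            = (LINT x:?O|lborel. f k x * g x - v x * g x)"
          using fg[OF H1(1)[of k]] fg[OF H1(2)] by (rule set_integral_diff(2)[symmetric])
        also have "\<dots> = (LINT x|lborel. indicator ?O x * ((f k x - v x) * g x))"
          by (simp add: set_lebesgue_integral_def algebra_simps)
        finally have "norm ((LINT x:?O|lborel. f k x * g x) - (LINT x:?O|lborel. v x * g x))
            \<le> (LINT x|lborel. \<bar>indicator ?O x * ((f k x - v x) * g x)\<bar>)"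
          by (simp only: real_norm_def integral_abs_bound)
        also have "\<dots> \<le> (LINT x|lborel. e' * \<bar>indicator ?O x * g x\<bar>)"
        proof (rule integral_mono)
          show "\<bar>indicator ?O x * ((f k x - v x) * g x)\<bar> \<le> e' * \<bar>indicator ?O x * g x\<bar>" for x
            using N[OF k, of x] by (cases "x \<in> ?O") (auto simp: abs_mult intro!: mult_right_mono)
        qed (use i gi in auto)
        also have "\<dots> = e' * L" by (simp add: L_def)
        also have "\<dots> < e" using e L by (simp add: e'_def field_simps)
        finally show "norm ((LINT x:?O|lborel. f k x * g x) - (LINT x:?O|lborel. v x * g x)) < e" .
      qed
    qed
    moreover have "(\<lambda>k. LINT x:?O|lborel. weak_deriv 1 1 ?O (f k) x * weak_deriv 1 1 ?O g x)
        \<longlonglongrightarrow> (LINT x:?O|lborel. weak_deriv 1 1 ?O v x * weak_deriv 1 1 ?O g x)"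
    proof -
      define D where "D k x = ?d (f k) x - ?d v x" for k x
      note dm = d(1)[OF H1(1)] d(1)[OF H1(2)] and di = d(2)[OF H1(1)] d(2)[OF H1(2)]
      have Dm: "D k \<in> borel_measurable lborel" for k
        unfolding D_def using dm by (intro borel_measurable_diff) auto
      have sq: "(D k x)\<^sup>2 \<le> 2 * (?d (f k) x)\<^sup>2 + 2 * (?d v x)\<^sup>2" for k x
        using sum_squares_bound[of "?d (f k) x" "- ?d v x"]
        unfolding D_def power2_diff by (simp only: power2_minus mult_minus_right)
      have bi: "integrable lborel (\<lambda>x. 2 * (?d (f k) x)\<^sup>2 + 2 * (?d v x)\<^sup>2)" for k
        using di(1)[of k] di(2) by simp
      have Di: "integrable lborel (\<lambda>x. (D k x)\<^sup>2)" for k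
      proof (rule Bochner_Integration.integrable_bound[OF bi])
        show "(\<lambda>x. (D k x)\<^sup>2) \<in> borel_measurable lborel" using Dm by (rule borel_measurable_power)
        show "AE x in lborel. norm ((D k x)\<^sup>2) \<le> norm (2 * (?d (f k) x)\<^sup>2 + 2 * (?d v x)\<^sup>2)"
          using sq by (intro AE_I2) simp
      qed
      have DK: "(LINT x|lborel. (D k x)\<^sup>2) \<le> 2 * K + 2 * (LINT x|lborel. (?d v x)\<^sup>2)" for k
      proof -
        have "(LINT x|lborel. (D k x)\<^sup>2) \<le> (LINT x|lborel. 2 * (?d (f k) x)\<^sup>2 + 2 * (?d v x)\<^sup>2)"
          by (intro integral_mono Di bi sq)
        also have "\<dots> = 2 * (LINT x|lborel. (?d (f k) x)\<^sup>2) + 2 * (LINT x|lborel. (?d v x)\<^sup>2)"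
          using di(1)[of k] di(2) by simp
        finally show ?thesis using K[of k] by (simp add: set_integral_square)
      qed
      have dprod: "integrable lborel (\<lambda>x. ?d h x * q x)"
        if "H1 ?O h" "q \<in> borel_measurable lborel" "integrable lborel (\<lambda>x. (q x)\<^sup>2)" for h and q :: "real \<Rightarrow> real"
        using d[OF that(1)] that(2,3) by (intro square_integrable_mult) auto
      have split: "(LINT x|lborel. D k x * q x) = (LINT x|lborel. ?d (f k) x * q x) - (LINT x|lborel. ?d v x * q x)"
        if "q \<in> borel_measurable lborel" "integrable lborel (\<lambda>x. (q x)\<^sup>2)" for k and q :: "real \<Rightarrow> real"
        unfolding D_def left_diff_distrib
        using dprod[OF H1(1)[of k] that] dprod[OF H1(2) that] by (rule Bochner_Integration.integral_diff)
      have "(\<lambda>k. LINT x|lborel. D k x * ?d g x) \<longlonglongrightarrow> 0"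
      proof (rule weak_L2_convergence_from_intervals[OF Dm Di DK])
        fix c d assume cd: "a < c" "c < d" "d < b"
        have ftc: "(LINT x|lborel. ?d h x * indicator {c<..d} x) = h d - h c"
          if "H1 ?O h" "continuous_on ?O h" for h
        proof -
          have "(LINT x|lborel. ?d h x * indicator {c<..d} x) = (LINT x:{c<..d}|lborel. weak_deriv 1 1 ?O h x)"
            unfolding set_lebesgue_integral_def
            by (intro Bochner_Integration.integral_cong) (use cd in \<open>auto simp: indicator_def\<close>)
          then show ?thesis using weak_deriv_FTC[OF that(2) H1_has_weak_deriv[OF that(1)] cd] by simp
        qed
        have "(\<lambda>k. (f k d - f k c) - (v d - v c)) \<longlonglongrightarrow> (v d - v c) - (v d - v c)"
          by (intro tendsto_intros pw) (use cd in auto)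
        moreover have "(LINT x|lborel. D k x * indicator {c<..d} x) = (f k d - f k c) - (v d - v c)" for k
          using split[of "indicator {c<..d}" k] i2[of c d] ftc[OF H1(1)[of k] cont] ftc[OF H1(2) cv] by simp
        ultimately show "(\<lambda>k. LINT x|lborel. D k x * indicator {c<..d} x) \<longlonglongrightarrow> 0" by simp
      qed (use d[OF g] in auto)
      then have "(\<lambda>k. (LINT x|lborel. ?d (f k) x * ?d g x) - (LINT x|lborel. ?d v x * ?d g x)) \<longlonglongrightarrow> 0"
        using split[OF d[OF g]] by simp
      then show ?thesis unfolding prod by (rule LIM_zero_cancel)
    qed
    ultimately show ?thesis unfolding H1_inner_def by (rule tendsto_add)
  qed
  then show ?thesis using H1 by (simp add: weak_conv_H1_def)
qed


section \<open>The parabolic profile\<close>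

text \<open>The parabola with zeros a and b, extended by 0. Its second derivative inside is -2 l, so
  l is half of \<lambda>.\<close>

definition cap :: "real \<Rightarrow> real \<Rightarrow> real \<Rightarrow> real \<Rightarrow> real" where
  "cap l a b x = indicator {a..b} x * (l * (x - a) * (b - x))"

lemma cap_outside: "x \<notin> {a<..<b} \<Longrightarrow> cap l a b x = 0"
  by (cases "x = a \<or> x = b") (auto simp: cap_def indicator_def)

lemma cap_inside: "x \<in> {a<..<b} \<Longrightarrow> cap l a b x = l * (x - a) * (b - x)"
  by (auto simp: cap_def)

lemma integrable_Icc_times_continuous:
  fixes f :: "real \<Rightarrow> real"
  assumes "continuous_on UNIV f"
  shows "integrable lborel (\<lambda>x. indicator {a..b} x * f x)"
  using borel_integrable_compact[of "{a..b}" f] continuous_on_subset[OF assms]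
  by simp

lemma integral_cap:
  assumes "a \<le> b"
  shows "(LINT x|lborel. cap l a b x) = l * (b - a) ^ 3 / 6"
proof -
  let ?F = "\<lambda>x. l * (- (x ^ 3) / 3 + (a + b) * x\<^sup>2 / 2 - a * b * x)"
  have "(LINT x|lborel. indicator {a..b} x *\<^sub>R (l * (x - a) * (b - x))) = ?F b - ?F a"
  proof (rule integral_FTC_atLeastAtMost[OF assms])
    fix x
    have "(?F has_real_derivative l * (x - a) * (b - x)) (at x within {a..b})"
      by (auto intro!: derivative_eq_intros simp: algebra_simps power2_eq_square)
    then show "(?F has_vector_derivative l * (x - a) * (b - x)) (at x within {a..b})"
      by (simp add: has_real_derivative_iff_has_vector_derivative)
  qed (intro continuous_intros)
  also have "\<dots> = l * (b - a) ^ 3 / 6"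
    by (simp add: power3_eq_cube power2_eq_square field_simps)
  finally show ?thesis by (simp add: cap_def)
qed

lemma L2_on_Icc_times_continuous:
  fixes f :: "real \<Rightarrow> real"
  assumes "continuous_on UNIV f" "{a..b} \<subseteq> U"
  shows "L2_on U (\<lambda>x. indicator {a..b} x * f x)"
proof -
  have "indicator U x * (indicator {a..b} x * f x) = indicator {a..b} x * f x" for x
    using assms(2) by (auto simp: indicator_def)
  moreover have "(\<lambda>x. indicator {a..b} x * f x) \<in> borel_measurable lborel"
    using integrable_Icc_times_continuous[OF assms(1)] by (rule borel_measurable_integrable)
  moreover have "integrable lborel (\<lambda>x. (indicator {a..b} x * f x)\<^sup>2)"
  proof -
    have "(\<lambda>x. (indicator {a..b} x * f x)\<^sup>2) = (\<lambda>x. indicator {a..b} x * (f x)\<^sup>2)"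
      by (auto simp: indicator_def fun_eq_iff)
    then show ?thesis
      using integrable_Icc_times_continuous[OF continuous_on_power[OF assms(1)]] by simp
  qed
  ultimately show ?thesis by (simp only: L2_on_iff simp_thms)
qed

lemma loc_integrable_Icc_times_continuous:
  fixes f :: "real \<Rightarrow> real"
  assumes "continuous_on UNIV f"
  shows "loc_integrable U (\<lambda>x. indicator {a..b} x * f x)"
  unfolding loc_integrable_def set_integrable_def
  by (intro allI impI integrable_mult_indicator integrable_Icc_times_continuous assms)
    (auto intro: borel_compact)

text \<open>The extension by zero has corners at a and b but no jumps. In the integration by parts
  over [a, b] the boundary terms vanish because the parabola does, whatever \<phi> is there; hence
  the weak derivative is the classical one cut off to [a, b].\<close>

lemma H1_cap:
  assumes ab: "a < b" and sub: "{a..b} \<subseteq> {\<alpha><..<\<beta>}"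
  shows "H1 {\<alpha><..<\<beta>} (cap l a b)"
proof -
  let ?O = "{\<alpha><..<\<beta>}" and ?v = "\<lambda>x. l * (x - a) * (b - x)" and ?g = "\<lambda>x. l * (a + b - 2 * x)"
  have c: "continuous_on UNIV ?v" "continuous_on UNIV ?g" by (intro continuous_intros)+
  have cap: "cap l a b = (\<lambda>x. indicator {a..b} x * ?v x)" by (simp add: cap_def fun_eq_iff)
  show ?thesis
  proof (rule H1I)
    \<comment> \<open>Clamping x to [a, b] writes the cut-off parabola as a composition of
      continuous functions.\<close>
    have "continuous_on UNIV (\<lambda>x. l * (max a (min b x) - a) * (b - max a (min b x)))"
      by (intro continuous_intros)
    moreover have "cap l a b = (\<lambda>x. l * (max a (min b x) - a) * (b - max a (min b x)))"
      using ab by (auto simp: cap_def indicator_def fun_eq_iff max_def min_def)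
    ultimately show "continuous_on ?O (cap l a b)" by (auto intro: continuous_on_subset)
    show "L2_on ?O (cap l a b)" unfolding cap by (rule L2_on_Icc_times_continuous[OF c(1) sub])
    show "L2_on ?O (\<lambda>x. indicator {a..b} x * ?g x)" by (rule L2_on_Icc_times_continuous[OF c(2) sub])
    show "has_weak_deriv 1 1 ?O (cap l a b) (\<lambda>x. indicator {a..b} x * ?g x)"
      unfolding has_weak_deriv_real_1
    proof (intro conjI allI impI)
      show "loc_integrable ?O (cap l a b)" "loc_integrable ?O (\<lambda>x. indicator {a..b} x * ?g x)"
        unfolding cap using c by (auto intro: loc_integrable_Icc_times_continuous)
      fix \<phi> :: "real \<Rightarrow> real" assume "test_fun ?O \<phi>"
      then have sm: "smooth_fun \<phi>" by (simp add: test_fun_def)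
      note d = smooth_fun_deriv(1)[OF sm]
      have c\<phi>: "continuous_on UNIV \<phi>" "continuous_on UNIV (dir_deriv 1 \<phi>)"
        using sm smooth_fun_deriv(2) smooth_fun_continuous by blast+
      have i: "integrable lborel (\<lambda>x. indicator {a..b} x * (?v x * dir_deriv 1 \<phi> x))"
        "integrable lborel (\<lambda>x. indicator {a..b} x * (?g x * \<phi> x))"
        by (intro integrable_Icc_times_continuous continuous_intros c\<phi>)+
      have r: "(LINT x:?O|lborel. indicator {a..b} x * p x * q x) = (LINT x|lborel. indicator {a..b} x * (p x * q x))"
        for p q :: "real \<Rightarrow> real"
        unfolding set_lebesgue_integral_def
        by (intro Bochner_Integration.integral_cong) (use sub in \<open>auto simp: indicator_def\<close>)
      have "(LINT x|lborel. indicator {a..b} x * (?v x * dir_deriv 1 \<phi> x)) + (LINT x|lborel. indicator {a..b} x * (?g x * \<phi> x))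
          = (LINT x|lborel. indicator {a..b} x *\<^sub>R (?v x * dir_deriv 1 \<phi> x + ?g x * \<phi> x))"
        using Bochner_Integration.integral_add[OF i] by (simp add: distrib_left)
      also have "\<dots> = ?v b * \<phi> b - ?v a * \<phi> a"
      proof (rule integral_FTC_atLeastAtMost)
        fix x
        have "((\<lambda>x. ?v x * \<phi> x) has_real_derivative ?v x * dir_deriv 1 \<phi> x + ?g x * \<phi> x) (at x within {a..b})"
          by (rule DERIV_subset[of _ _ _ UNIV], (rule derivative_eq_intros d refl)+)
            (auto simp: algebra_simps)
        then show "((\<lambda>x. ?v x * \<phi> x) has_vector_derivative ?v x * dir_deriv 1 \<phi> x + ?g x * \<phi> x) (at x within {a..b})"
          by (simp add: has_real_derivative_iff_has_vector_derivative)
      qed (use ab in \<open>auto intro!: continuous_intros continuous_on_subset[OF c\<phi>(1)] continuous_on_subset[OF c\<phi>(2)]\<close>)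
      finally show "(LINT x:?O|lborel. cap l a b x * dir_deriv 1 \<phi> x)
          = - (LINT x:?O|lborel. indicator {a..b} x * ?g x * \<phi> x)"
        unfolding cap r by simp
    qed
  qed
qed

lemma cap_derivatives:
  assumes "x \<in> {a<..<b}"
  shows "(cap l a b has_real_derivative l * (a + b - 2 * x)) (at x)"
    and "((\<lambda>x. l * (a + b - 2 * x)) has_real_derivative - (2 * l)) (at x)"
proof -
  have "((\<lambda>x. l * (x - a) * (b - x)) has_real_derivative l * (a + b - 2 * x)) (at x)"
    by (auto intro!: derivative_eq_intros simp: algebra_simps)
  then show "(cap l a b has_real_derivative l * (a + b - 2 * x)) (at x)"
    by (rule has_field_derivative_transform_within_open[of _ _ _ "{a<..<b}"])
      (use assms in \<open>auto simp: cap_inside\<close>)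
  show "((\<lambda>x. l * (a + b - 2 * x)) has_real_derivative - (2 * l)) (at x)"
    by (auto intro!: derivative_eq_intros)
qed

section \<open>Identification of the accumulation points\<close>

lemma quadratic_with_two_roots:
  fixes p :: "real poly"
  assumes "degree p \<le> 2" "poly p a = 0" "poly p b = 0" "a \<noteq> b"
  obtains l where "\<And>x. poly p x = l * (x - a) * (b - x)"
proof -
  have p: "poly p x = coeff p 0 + coeff p 1 * x + coeff p 2 * x\<^sup>2" for x
  proof -
    have "poly p x = (\<Sum>i\<le>2. coeff p i * x ^ i)"
      unfolding poly_altdef using assms(1)
      by (intro sum.mono_neutral_left) (auto simp: coeff_eq_0)
    then show ?thesis by (simp add: numeral_2_eq_2)
  qed
  have "(b - a) * (coeff p 1 + coeff p 2 * (a + b)) = poly p b - poly p a"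
    by (simp add: p algebra_simps power2_eq_square)
  then have 1: "coeff p 1 = - coeff p 2 * (a + b)" using assms by simp
  have 0: "coeff p 0 = coeff p 2 * (a * b)"
    using p[of a] assms(2) unfolding 1 by (simp add: algebra_simps power2_eq_square)
  show thesis
  proof (rule that)
    \<comment> \<open>Equal values at two points give the linear coefficient, the root a gives the
      constant one. A degree below 2 is the case l = 0.\<close>
    show "poly p x = (- coeff p 2) * (x - a) * (b - x)" for x
      by (simp add: p 0 1[unfolded One_nat_def] algebra_simps power2_eq_square)
  qed
qed

lemma accumulation_point_eq_cap:
  fixes w :: "real \<Rightarrow> real"
  assumes ab: "a < b" and sub: "{a..b} \<subseteq> {\<alpha><..<\<beta>}"
    and w: "continuous_on {\<alpha><..<\<beta>} w" "\<And>x. x \<in> {\<alpha><..<\<beta>} \<Longrightarrow> 0 \<le> w x"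
    and weak: "has_weak_deriv 1 3 {x\<in>{\<alpha><..<\<beta>}. 0 < w x} w (\<lambda>_. 0)"
    and mass: "(LINT x:{\<alpha><..<\<beta>}|lborel. w x) = 1"
    and pos: "{x\<in>{\<alpha><..<\<beta>}. 0 < w x} \<subseteq> {a<..<b}"
      "frontier {x\<in>{\<alpha><..<\<beta>}. 0 < w x} \<inter> {a<..<b} = {}"
  shows "\<forall>x\<in>{\<alpha><..<\<beta>}. w x = cap (6 / (b - a) ^ 3) a b x"
proof -
  let ?O = "{\<alpha><..<\<beta>}" and ?P = "{x\<in>{\<alpha><..<\<beta>}. 0 < w x}"
  have "?P \<noteq> {}"
  proof
    assume "?P = {}"
    then have "w x = 0" if "x \<in> ?O" for x using w(2)[OF that] that by force
    then have "(LINT x:?O|lborel. w x) = (LINT x:?O|lborel. 0)"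
      by (intro set_lebesgue_integral_cong) auto
    then show False using mass by simp
  qed
  \<comment> \<open>A connected set that meets P but not its frontier lies inside P; hence P fills
    (a, b).\<close>
  then have "{a<..<b} \<inter> ?P \<noteq> {}" using pos(1) by blast
  moreover have "connected {a<..<b}" by simp
  ultimately have "{a<..<b} - ?P = {}" using connected_Int_frontier[of "{a<..<b}" ?P] pos(2)
    by (metis inf_commute)
  then have P: "?P = {a<..<b}" using pos(1) by blast
  \<comment> \<open>Both ends are points of the larger interval outside the positivity set, so w is
    0 there and continuity from inside provides the two roots of the polynomial.\<close>
  have abO: "a \<in> ?O" "b \<in> ?O" using ab by (auto intro!: subsetD[OF sub] simp del: greaterThanLessThan_iff)
  have zero: "w x = 0" if "x \<in> ?O" "x \<notin> {a<..<b}" for x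
    using P w(2)[OF that(1)] that by force
  have cw: "continuous_on {a..b} w" using w(1) sub by (rule continuous_on_subset)
  have "\<exists>p. (\<forall>x\<in>{a<..<b}. w x = poly p x) \<and> (p = 0 \<or> degree p < 3)"
  proof (rule weak_deriv_zero_imp_poly[OF ab])
    show "continuous_on {a<..<b} w" using cw by (rule continuous_on_subset) auto
    show "(LINT x:{a<..<b}|lborel. w x * (dir_deriv 1 ^^ 3) \<phi> x) = 0" if "test_fun {a<..<b} \<phi>" for \<phi>
      using weak that unfolding P has_weak_deriv_def by simp
  qed
  then obtain p where p: "\<And>x. x \<in> {a<..<b} \<Longrightarrow> w x = poly p x" and "p = 0 \<or> degree p < 3" by blast
  then have deg: "degree p \<le> 2" by auto
  have pw: "w x = poly p x" if "x \<in> {a..b}" for x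
  proof -
    have "closure {a<..<b} = {a..b}" using ab by simp
    moreover have "w x - poly p x = 0" if "x \<in> closure {a<..<b}" for x
      using that
      by (rule continuous_constant_on_closure[rotated 2])
        (use ab p in \<open>auto intro!: continuous_intros cw\<close>)
    ultimately show ?thesis using that by simp
  qed
  have "poly p a = 0" "poly p b = 0" using pw[of a] pw[of b] zero[of a] zero[of b] abO ab by auto
  then obtain l where l: "\<And>x. poly p x = l * (x - a) * (b - x)"
    using quadratic_with_two_roots[OF deg] ab by (metis less_irrefl)
  have eq: "w x = cap l a b x" if "x \<in> ?O" for x
    using zero[OF that] p[of x] cap_outside[of x a b l] cap_inside[of x a b l] l
    by (cases "x \<in> {a<..<b}") auto
  have "(LINT x:?O|lborel. w x) = (LINT x|lborel. cap l a b x)"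
    unfolding set_lebesgue_integral_def
  proof (intro Bochner_Integration.integral_cong refl)
    fix x
    have "{a<..<b} \<subseteq> {a..b}" by auto
    with sub have "x \<notin> ?O \<Longrightarrow> cap l a b x = 0" by (intro cap_outside) blast
    then show "indicator ?O x *\<^sub>R w x = cap l a b x"
      using eq[of x] by (cases "x \<in> ?O") auto
  qed
  then have "l * (b - a) ^ 3 / 6 = 1" using mass integral_cap[of a b l] ab by simp
  then have "l = 6 / (b - a) ^ 3" using ab by (simp add: field_simps)
  then show ?thesis using eq by simp
qed

text \<open>The bounds hold at every positive time and do not depend on \<epsilon>: mass and energy
  are compared with those of the initial datum.\<close>

lemma thin_film_slice:
  assumes sol: "thin_film_solution {\<alpha><..<\<beta>} n e u_in u" and ab: "\<alpha> < \<beta>" and t: "0 < t"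
    and u_in: "H1 {\<alpha><..<\<beta>} u_in" "(LINT x:{\<alpha><..<\<beta>}|lborel. u_in x) = 1"
  shows "continuous_on {\<alpha>..\<beta>} (u t)" "\<And>x. x \<in> {\<alpha>..\<beta>} \<Longrightarrow> 0 \<le> u t x" "H1 {\<alpha><..<\<beta>} (u t)"
    "(LINT x:{\<alpha><..<\<beta>}|lborel. u t x) = 1"
    "(LINT x:{\<alpha><..<\<beta>}|lborel. (weak_deriv 1 1 {\<alpha><..<\<beta>} (u t) x)\<^sup>2)
      \<le> (LINT x:{\<alpha><..<\<beta>}|lborel. (weak_deriv 1 1 {\<alpha><..<\<beta>} u_in x)\<^sup>2)"
proof -
  let ?O = "{\<alpha><..<\<beta>}"
  have cl: "closure ?O = {\<alpha>..\<beta>}" using ab by simp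
  have c: "continuous_on ({0..} \<times> {\<alpha>..\<beta>}) (\<lambda>(t, x). u t x)"
    using sol unfolding thin_film_solution_def cl by blast
  have "continuous_on {\<alpha>..\<beta>} (\<lambda>x. (\<lambda>(t, x). u t x) (t, x))"
    by (rule continuous_on_compose2[OF c]) (use t in \<open>auto intro!: continuous_intros\<close>)
  then show "continuous_on {\<alpha>..\<beta>} (u t)" by simp
  show "0 \<le> u t x" if "x \<in> {\<alpha>..\<beta>}" for x
    using sol t that unfolding thin_film_solution_def cl by auto
  show H1: "H1 ?O (u t)"
    using sol t unfolding thin_film_solution_def energy_inequality_def by blast
  show "(LINT x:?O|lborel. u t x) = 1"
    using sol t u_in(2) unfolding thin_film_solution_def mass_conservation_def by simp
  have nn: "(\<integral>\<^sup>+ x\<in>?O. ennreal ((weak_deriv 1 1 ?O h x)\<^sup>2) \<partial>lborel)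
      = ennreal (LINT x:?O|lborel. (weak_deriv 1 1 ?O h x)\<^sup>2)" if "H1 ?O h" for h
  proof -
    have "(\<integral>\<^sup>+ x\<in>?O. ennreal ((weak_deriv 1 1 ?O h x)\<^sup>2) \<partial>lborel)
        = (\<integral>\<^sup>+ x. ennreal ((indicator ?O x * weak_deriv 1 1 ?O h x)\<^sup>2) \<partial>lborel)"
      by (intro nn_integral_cong) (auto simp: indicator_def)
    also have "\<dots> = ennreal (LINT x|lborel. (indicator ?O x * weak_deriv 1 1 ?O h x)\<^sup>2)"
      by (rule nn_integral_eq_integral) (use that in \<open>auto simp: H1_def L2_on_iff\<close>)
    finally show ?thesis by (simp add: set_integral_square)
  qed
  \<comment> \<open>The dissipation term is nonnegative and is dropped.\<close>
  have e: "ennreal (1/2) * (\<integral>\<^sup>+ x\<in>?O. ennreal ((weak_deriv 1 1 ?O (u t) x)\<^sup>2) \<partial>lborel)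
      \<le> ennreal (1/2) * (\<integral>\<^sup>+ x\<in>?O. ennreal ((weak_deriv 1 1 ?O u_in x)\<^sup>2) \<partial>lborel)"
    using sol t unfolding thin_film_solution_def energy_inequality_def u_x_def
    by (blast intro: order_trans[OF add_increasing2[OF zero_le order_refl]])
  have p: "0 \<le> (LINT x:?O|lborel. (weak_deriv 1 1 ?O h x)\<^sup>2)" for h
    by (simp add: set_integral_square)
  show "(LINT x:?O|lborel. (weak_deriv 1 1 ?O (u t) x)\<^sup>2)
      \<le> (LINT x:?O|lborel. (weak_deriv 1 1 ?O u_in x)\<^sup>2)"
  proof -
    have "ennreal (1/2) * ennreal c = ennreal (1/2 * c)" for c by (rule ennreal_mult'[symmetric]) simp
    with e have "ennreal (1/2 * (LINT x:?O|lborel. (weak_deriv 1 1 ?O (u t) x)\<^sup>2))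
        \<le> ennreal (1/2 * (LINT x:?O|lborel. (weak_deriv 1 1 ?O u_in x)\<^sup>2))"
      by (simp only: nn[OF H1] nn[OF u_in(1)])
    then show ?thesis using p by (subst (asm) ennreal_le_iff) simp_all
  qed
qed

theorem corollary1p8:
  fixes \<alpha> \<beta> n p :: real
    and \<Omega> :: "real set"
    and u_in :: "real \<Rightarrow> real"
    and u :: "real \<Rightarrow> real \<Rightarrow> real \<Rightarrow> real"
    and \<rho> :: "real \<Rightarrow> real \<Rightarrow> real"
    and \<epsilon> :: "nat \<Rightarrow> real"
    and \<sigma> :: "nat \<Rightarrow> nat"
  assumes "\<alpha> < \<beta>" and "\<Omega> = {\<alpha><..<\<beta>}"
    and "0 < n" and "n < 3"
    and "H1 \<Omega> u_in" and "AE x in lborel. x \<in> \<Omega> \<longrightarrow> 0 \<le> u_in x"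
    and "(LINT x:\<Omega>|lborel. u_in x) = 1"
    and "\<And>e. 0 < e \<Longrightarrow> e \<le> 1/2 \<Longrightarrow> thin_film_solution \<Omega> n e u_in (u e)"
    and "\<And>k. 0 < \<epsilon> k \<and> \<epsilon> k \<le> 1/2" and "\<epsilon> \<longlonglongrightarrow> 0"
    and "1 \<le> p"
    and "\<And>T. 0 < T \<Longrightarrow> conv_Lp_Wm11 p T \<Omega> (\<lambda>k. rho_of n (\<epsilon> k) (u (\<epsilon> k))) \<rho>"
    and "strict_mono \<sigma>"
    and "AE t in lborel. 0 < t \<longrightarrow>
           (\<forall>v. accum_point \<Omega> (\<lambda>k. u (\<epsilon> (\<sigma> k)) t) v \<longrightarrow>
              has_weak_deriv 1 3 {x\<in>\<Omega>. 0 < v x} v (\<lambda>_. 0) \<and>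
              (LINT x:\<Omega>|lborel. v x) = 1 \<and>
              {x\<in>\<Omega>. 0 < v x} \<subseteq> Sigma_set \<Omega> \<rho> t \<and>
              frontier {x\<in>\<Omega>. 0 < v x} \<inter> Sigma_set \<Omega> \<rho> t = {})"
  shows "AE t in lborel. 0 < t \<longrightarrow>
           (\<forall>a b. a < b \<and> Sigma_set \<Omega> \<rho> t = {a<..<b} \<and> {a..b} \<subseteq> \<Omega> \<longrightarrow>
              (\<exists>v. H1 \<Omega> v \<and>
                 accum_point \<Omega> (\<lambda>k. u (\<epsilon> (\<sigma> k)) t) v \<and>
                 (\<forall>w. accum_point \<Omega> (\<lambda>k. u (\<epsilon> (\<sigma> k)) t) w \<longrightarrow> (\<forall>x\<in>\<Omega>. w x = v x)) \<and>
                 (\<forall>x\<in>\<Omega> - {a<..<b}. v x = 0) \<and>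
                 (\<exists>lam v'. \<forall>x\<in>{a<..<b}. (v has_real_derivative v' x) (at x) \<and>
                                        (v' has_real_derivative - lam) (at x)) \<and>
                 (LINT x:{a<..<b}|lborel. v x) = 1 \<and>
                 uniform_limit \<Omega> (\<lambda>k. u (\<epsilon> (\<sigma> k)) t) v sequentially \<and>
                 weak_conv_H1 \<Omega> (\<lambda>k. u (\<epsilon> (\<sigma> k)) t) v))"
  using assms(14)
proof eventually_elim
  \<comment> \<open>From here on t is fixed and the argument is purely spatial.\<close>
  case (elim t)
  let ?f = "\<lambda>k. u (\<epsilon> (\<sigma> k)) t"
  show ?case
  proof (intro impI allI, elim conjE)
    fix a b assume t: "0 < t" and ab: "a < b" and \<Sigma>: "Sigma_set \<Omega> \<rho> t = {a<..<b}" and sub: "{a..b} \<subseteq> \<Omega>"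
    let ?v = "cap (6 / (b - a) ^ 3) a b"
    note [simp] = assms(2)
    have sol: "thin_film_solution {\<alpha><..<\<beta>} n (\<epsilon> (\<sigma> k)) u_in (u (\<epsilon> (\<sigma> k)))" for k
      using assms(8)[of "\<epsilon> (\<sigma> k)"] assms(9) by simp
    note slice = thin_film_slice[OF sol assms(1) t assms(5)[unfolded assms(2)] assms(7)[unfolded assms(2)]]
    have cont: "continuous_on {\<alpha><..<\<beta>} (?f k)" for k
      using slice(1) by (rule continuous_on_subset) auto
    have unique: "\<forall>x\<in>\<Omega>. w x = ?v x" if acc: "accum_point \<Omega> ?f w" for w
    proof -
      obtain s where s: "strict_mono s" "uniform_limit {\<alpha><..<\<beta>} (\<lambda>j. ?f (s j)) w sequentially"
        using acc by (auto simp: accum_point_def)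
      have cw: "continuous_on {\<alpha><..<\<beta>} w"
        by (rule uniform_limit_theorem[OF _ s(2)]) (simp_all add: cont)
      have nonneg: "0 \<le> w x" if x: "x \<in> {\<alpha><..<\<beta>}" for x
        using slice(2) x by (intro LIMSEQ_le_const[OF tendsto_uniform_limitI[OF s(2) x]]) auto
      show ?thesis
        using accumulation_point_eq_cap[OF ab _ cw nonneg] elim t acc sub \<Sigma> by simp
    qed
    \<comment> \<open>The bounds are uniform in k, so each subsequence accumulates, and only at the
      cap. That the cap is an accumulation point at all then follows with the identity as
      subsequence.\<close>
    have unif: "uniform_limit \<Omega> ?f ?v sequentially"
    proof (rule uniform_limit_if_unique_accumulation[OF _ unique])
      fix s :: "nat \<Rightarrow> nat"
      show "\<exists>r w. strict_mono (r :: nat \<Rightarrow> nat) \<and> uniform_limit \<Omega> (\<lambda>j. ?f (s (r j))) w sequentially"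
        using H1_bounded_compactness[where f = "\<lambda>j. ?f (s j)", OF assms(1) slice(3) slice(1) slice(2) slice(4) slice(5)]
        by (metis assms(2))
    qed
    have H1: "H1 \<Omega> ?v" using H1_cap[OF ab] sub by simp
    show "\<exists>v. H1 \<Omega> v \<and>
                 accum_point \<Omega> ?f v \<and>
                 (\<forall>w. accum_point \<Omega> ?f w \<longrightarrow> (\<forall>x\<in>\<Omega>. w x = v x)) \<and>
                 (\<forall>x\<in>\<Omega> - {a<..<b}. v x = 0) \<and>
                 (\<exists>lam v'. \<forall>x\<in>{a<..<b}. (v has_real_derivative v' x) (at x) \<and>
                                        (v' has_real_derivative - lam) (at x)) \<and>
                 (LINT x:{a<..<b}|lborel. v x) = 1 \<and>
                 uniform_limit \<Omega> ?f v sequentially \<and>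
                 weak_conv_H1 \<Omega> ?f v"
    proof (intro exI[of _ ?v] conjI)
      show "accum_point \<Omega> ?f ?v"
        unfolding accum_point_def using unif by (intro exI[of _ id]) (simp add: strict_mono_def)
      show "\<forall>x\<in>\<Omega> - {a<..<b}. ?v x = 0" by (simp add: cap_outside)
      show "\<exists>lam v'. \<forall>x\<in>{a<..<b}. (?v has_real_derivative v' x) (at x) \<and>
          (v' has_real_derivative - lam) (at x)"
        \<comment> \<open>Here l = 6 / (b - a)^3 from mass one, and \<lambda> = 2 l.\<close>
        using cap_derivatives
        by (intro exI[of _ "2 * (6 / (b - a) ^ 3)"] exI[of _ "\<lambda>x. 6 / (b - a) ^ 3 * (a + b - 2 * x)"]) blast
      have "(LINT x:{a<..<b}|lborel. ?v x) = (LINT x|lborel. ?v x)"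
        unfolding set_lebesgue_integral_def
      proof (intro Bochner_Integration.integral_cong refl)
        show "indicator {a<..<b} x *\<^sub>R ?v x = ?v x" for x
          by (cases "x \<in> {a<..<b}") (simp_all add: cap_outside)
      qed
      then show "(LINT x:{a<..<b}|lborel. ?v x) = 1" using integral_cap[of a b] ab by simp
      show "weak_conv_H1 \<Omega> ?f ?v"
        using weak_conv_H1_if_uniform_limit[OF slice(3) _ cont slice(5)] H1 unif by simp
    qed (use H1 unif unique in auto)
  qed
qed

end
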